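(* Let $\boldsymbol{F}$, $\boldsymbol{\beta}$, $\boldsymbol{e}$, $S$, $T$ and the estimator $\hat{\boldsymbol{\beta}}$ be as described in the context, with dimension $D$. Let $\lambda_1,\dots,\lambda_{|S|}$ be the eigenvalues (with multiplicity) of the matrix $\boldsymbol{F}_{S,T^c}\boldsymbol{F}_{S,T^c}^*$. Then $$\mathbb{E}_{\boldsymbol{e},\boldsymbol{\beta}}\big[\|\boldsymbol{\beta}-\hat{\boldsymbol{\beta}}\|^2 \,\big|\, S,T\big] = 1-\frac{2\,\mathrm{rank}(\boldsymbol{F}_{S,T})}{D}+\frac{1+\sigma^2}{D}\sum_{i=1}^{|S|}\frac{1}{1-\lambda_i}\mathbf{1}_{\lambda_i<1},$$ where a term with $\lambda_i=1$ is interpreted as $0$.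
   Context: $[D]=\{1,\dots,D\}$. $\boldsymbol{F}\in\mathbb{C}^{D\times D}$ is the DFT matrix with entries $F_{i,j}=\frac{1}{\sqrt D}\omega^{(i-1)(j-1)}$, $\omega=\exp(-2\pi \mathrm{i}/D)$. For index sets $S,T\subset[D]$, $\boldsymbol{F}_{S,T}$ is the submatrix with rows in $S$ and columns in $T$; $\boldsymbol{z}_S$ is the subvector of $\boldsymbol{z}$ with entries in $S$; $T^c=[D]\setminus T$. $\boldsymbol{Z}^*$ is the conjugate transpose, $\boldsymbol{Z}^\dagger$ the Moore–Penrose inverse, and $\|\cdot\|$ the Euclidean norm. Model: $\boldsymbol{\beta}\in\mathbb{C}^D$ is random with $\mathbb{E}[\boldsymbol{\beta}\boldsymbol{\beta}^*]=\frac1D\boldsymbol{I}_D$. The noise $\boldsymbol{e}\in\mathbb{C}^D$ satisfies $\mathrm{Re}(\boldsymbol{e}),\mathrm{Im}(\boldsymbol{e})\sim\mathcal{N}(0,\frac{\sigma^2}{2D}\boldsymbol{I}_D)$ independently. One sets $\boldsymbol{\mu}=\boldsymbol{F}\boldsymbol{\beta}+\boldsymbol{e}$. $S$ and $T$ are independent random subsets of $[D]$ with $\mathbb{E}|S|=n$, $\mathbb{E}|T|=p$: each $i\in[D]$ belongs to $S$ (respectively $T$) according to an independent Bernoulli variable with mean $\rho_n=n/D$ (respectively $\rho_p=p/D$). $\boldsymbol{\beta}$ is independent of $S$, $T$ and $\boldsymbol{e}$. The estimator is $\hat{\boldsymbol{\beta}}_T=\boldsymbol{F}_{S,T}^\dagger\boldsymbol{\mu}_S$,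 $\hat{\boldsymbol{\beta}}_{T^c}=\boldsymbol{0}$. $\mathbb{E}_{\boldsymbol{e},\boldsymbol{\beta}}[\,\cdot\mid S,T]$ denotes expectation over $\boldsymbol{e}$ and $\boldsymbol{\beta}$ with $S$ and $T$ held fixed. *)

theory Defs
  imports
    "HOL-Probability.Probability"
    "Jordan_Normal_Form.DL_Submatrix"
    "Jordan_Normal_Form.DL_Rank"
    "Jordan_Normal_Form.Schur_Decomposition"
begin

unbundle no vec_syntax

(* Indices are 0-based: the index set [D] is {..<D}. *)

definition dft :: "nat \<Rightarrow> complex mat" where
  "dft D = mat D D (\<lambda>(i, j).
     complex_of_real (1 / sqrt (real D)) *
     exp (- (2 * complex_of_real pi * \<i> / of_nat D)) ^ (i * j))"

(* The vector analogue of submatrix, with the same enumeration of S. *)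
definition subvec :: "'a Matrix.vec \<Rightarrow> nat set \<Rightarrow> 'a Matrix.vec" where
  "subvec v S = Matrix.vec (card {i. i < dim_vec v \<and> i \<in> S}) (\<lambda>k. v $ pick S k)"

(* The D-dimensional vector u with u_T = w and zero entries outside T:
   card {j \<in> T. j < i} is the position of i in the increasing enumeration of T. *)
definition zero_extend :: "nat \<Rightarrow> nat set \<Rightarrow> 'a :: zero Matrix.vec \<Rightarrow> 'a Matrix.vec" where
  "zero_extend D T w = Matrix.vec D (\<lambda>i. if i \<in> T then w $ card {j \<in> T. j < i} else 0)"

lemma zero_extend_outside: "i < D \<Longrightarrow> i \<notin> T \<Longrightarrow> zero_extend D T w $ i = 0"
  by (simp add: zero_extend_def)

lemma subvec_zero_extend:
  assumes "T \<subseteq> {..<D}" "dim_vec w = card T"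
  shows "subvec (zero_extend D T w) T = w"
proof (rule eq_vecI)
  have T: "{i. i < D \<and> i \<in> T} = T" "finite T"
    using assms(1) finite_subset by auto
  then show "dim_vec (subvec (zero_extend D T w) T) = dim_vec w"
    using assms(2) by (simp add: subvec_def zero_extend_def)
  fix k assume k: "k < dim_vec w"
  then have "pick T k \<in> T"
    using assms(2) pick_in_set by metis
  moreover from this have "pick T k < D"
    using assms(1) by auto
  moreover have "card {j \<in> T. j < pick T k} = k"
    using k assms(2) card_pick by metis
  ultimately show "subvec (zero_extend D T w) T $ k = w $ k"
    using k T assms(2) by (simp add: subvec_def zero_extend_def)
qed

definition is_pseudoinverse :: "complex mat \<Rightarrow> complex mat \<Rightarrow> bool" where
  "is_pseudoinverse A X \<longleftrightarrow>
     X \<in> carrier_mat (dim_col A) (dim_row A) \<and>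
     A * X * A = A \<and> X * A * X = X \<and>
     mat_adjoint (A * X) = A * X \<and> mat_adjoint (X * A) = X * A"

definition pseudoinverse :: "complex mat \<Rightarrow> complex mat" where
  "pseudoinverse A = (THE X. is_pseudoinverse A X)"

definition vec_norm2 :: "complex Matrix.vec \<Rightarrow> real" where
  "vec_norm2 v = L2_set (\<lambda>i. cmod (v $ i)) {..<dim_vec v}"

definition estimator :: "nat \<Rightarrow> nat set \<Rightarrow> nat set \<Rightarrow> complex Matrix.vec \<Rightarrow> complex Matrix.vec" where
  "estimator D S T \<mu> =
     zero_extend D T (pseudoinverse (submatrix (dft D) S T) *\<^sub>v subvec \<mu> S)"

(* D-dimensional complex vectors with the sigma-algebra generated by the coordinates. *)
definition borel_vec :: "nat \<Rightarrow> complex Matrix.vec measure" where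
  "borel_vec D = vimage_algebra (carrier_vec D) (\<lambda>v. \<lambda>i\<in>{..<D}. v $ i) (\<Pi>\<^sub>M i\<in>{..<D}. borel)"

definition index_sets :: "nat \<Rightarrow> nat set measure" where
  "index_sets D = count_space (Pow {..<D})"

(* N(m, v) with v the variance; v = 0 is the point mass, which covers the noiseless case. *)
definition gaussian :: "real \<Rightarrow> real \<Rightarrow> real measure" where
  "gaussian m v =
     (if v = 0 then return borel m
      else density lborel (\<lambda>x. ennreal (normal_density m (sqrt v) x)))"

(* Independence of two random variables; indep_var requires them to have the same type. *)
definition (in prob_space) indep_rv ::
    "'b measure \<Rightarrow> ('a \<Rightarrow> 'b) \<Rightarrow> 'c measure \<Rightarrow> ('a \<Rightarrow> 'c) \<Rightarrow> bool" where
  "indep_rv N X L Y \<longleftrightarrow>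
     random_variable N X \<and> random_variable L Y \<and>
     indep_set {X -` A \<inter> space M |A. A \<in> sets N} {Y -` B \<inter> space M |B. B \<in> sets L}"

locale dft_model = prob_space M
  for M :: "'w measure" +
  fixes D :: nat and n p \<sigma> :: real
    and \<beta> e :: "'w \<Rightarrow> complex Matrix.vec"
    and S T :: "'w \<Rightarrow> nat set"
  assumes D_pos: "0 < D"
    and n_bounds: "0 \<le> n" "n \<le> real D"
    and p_bounds: "0 \<le> p" "p \<le> real D"
    and beta_rv: "random_variable (borel_vec D) \<beta>"
    and e_rv: "random_variable (borel_vec D) e"
    and S_rv: "random_variable (index_sets D) S"
    and T_rv: "random_variable (index_sets D) T"
    and beta_integrable:
      "\<And>i j. i < D \<Longrightarrow> j < D \<Longrightarrow> integrable M (\<lambda>x. \<beta> x $ i * cnj (\<beta> x $ j))"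
    and beta_second_moment:
      "\<And>i j. i < D \<Longrightarrow> j < D \<Longrightarrow>
        (LINT x|M. \<beta> x $ i * cnj (\<beta> x $ j)) = (if i = j then 1 / of_nat D else 0)"
    and e_Re: "distr M (\<Pi>\<^sub>M i\<in>{..<D}. borel) (\<lambda>x. \<lambda>i\<in>{..<D}. Re (e x $ i)) =
      (\<Pi>\<^sub>M i\<in>{..<D}. gaussian 0 (\<sigma>\<^sup>2 / (2 * real D)))"
    and e_Im: "distr M (\<Pi>\<^sub>M i\<in>{..<D}. borel) (\<lambda>x. \<lambda>i\<in>{..<D}. Im (e x $ i)) =
      (\<Pi>\<^sub>M i\<in>{..<D}. gaussian 0 (\<sigma>\<^sup>2 / (2 * real D)))"
    and e_Re_Im_indep:
      "indep_var (\<Pi>\<^sub>M i\<in>{..<D}. borel) (\<lambda>x. \<lambda>i\<in>{..<D}. Re (e x $ i))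
                 (\<Pi>\<^sub>M i\<in>{..<D}. borel) (\<lambda>x. \<lambda>i\<in>{..<D}. Im (e x $ i))"
    and S_indep: "indep_vars (\<lambda>_. count_space UNIV) (\<lambda>i x. i \<in> S x) {..<D}"
    and S_bernoulli: "\<And>i. i < D \<Longrightarrow>
      distr M (count_space UNIV) (\<lambda>x. i \<in> S x) = measure_pmf (bernoulli_pmf (n / real D))"
    and T_indep: "indep_vars (\<lambda>_. count_space UNIV) (\<lambda>i x. i \<in> T x) {..<D}"
    and T_bernoulli: "\<And>i. i < D \<Longrightarrow>
      distr M (count_space UNIV) (\<lambda>x. i \<in> T x) = measure_pmf (bernoulli_pmf (p / real D))"
    and S_T_indep: "indep_var (index_sets D) S (index_sets D) T"
    and beta_indep:
      "indep_rv (borel_vec D) \<beta>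
         (index_sets D \<Otimes>\<^sub>M index_sets D \<Otimes>\<^sub>M borel_vec D) (\<lambda>x. (S x, T x, e x))"

end

theory Submission
  imports Defs
begin

text \<open>
  Fix \<open>S\<close> and \<open>T\<close>, let \<open>A\<close> be the submatrix of the DFT matrix \<open>F\<close> with rows \<open>S\<close> and columns \<open>T\<close>,
  and let \<open>X\<close> be its Moore--Penrose inverse. Put the entries of \<open>X\<close> at the rows \<open>T\<close> and the columns
  \<open>S\<close> of a zero matrix of size \<open>D\<close>; call the result \<open>Y\<close> (\<open>estimator_mat\<close>). The estimator is
  then multiplication by \<open>Y\<close> in the full space, so the error is \<open>(I - Y F) \<beta> - Y e\<close>. The entries
  of \<open>\<beta>\<close> and \<open>e\<close> are mutually uncorrelated, with second moments \<open>1/D\<close> and \<open>\<sigma>\<^sup>2/D\<close>; hence the mean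
  squared error is \<open>(\<parallel>I - Y F\<parallel>\<^sup>2 + \<sigma>\<^sup>2 \<parallel>Y\<parallel>\<^sup>2) / D\<close> in the Frobenius norm (\<open>risk\<close>).

  What remains is linear algebra. As \<open>F\<close> is unitary, \<open>\<parallel>Y F\<parallel> = \<parallel>Y\<parallel> = \<parallel>X\<parallel>\<close>, so
  \<open>\<parallel>I - Y F\<parallel>\<^sup>2 = D - 2 Re tr (Y F) + \<parallel>X\<parallel>\<^sup>2\<close>. Here \<open>tr (Y F) = tr (A X)\<close>, and \<open>A X\<close> is the
  orthogonal projection onto the column space of \<open>A\<close>, whose trace is \<open>rank A\<close>
  (\<open>mtrace_mult_pseudoinverse_eq_rank\<close>). Finally \<open>\<parallel>X\<parallel>\<^sup>2\<close> is the sum of \<open>1/b\<close> over the nonzero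
  eigenvalues \<open>b\<close> of \<open>A A\<^sup>*\<close>. If \<open>B\<close> is the submatrix with rows \<open>S\<close> and the columns outside \<open>T\<close>,
  the orthonormality of the rows of \<open>F\<close> says \<open>A A\<^sup>* + B B\<^sup>* = I\<close>, so these \<open>b\<close> are the numbers
  \<open>1 - \<lambda>\<close> for the eigenvalues \<open>\<lambda> < 1\<close> of \<open>B B\<^sup>*\<close> (\<open>frobenius2_pseudoinverse_complementary\<close>).
  All of this is read off from a unitary diagonalization of \<open>A A\<^sup>*\<close>
  (\<open>hermitian_unitary_diagonalization\<close>).

  For the conditional expectation, \<open>(S, T)\<close> has finitely many values, so it suffices to integrate
  the error for fixed index sets over events \<open>(S, T) \<in> Q\<close>. Independence lets the indicator of such
  an event factor out of every second moment, so the integral is the probability of the event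
  times the risk (\<open>restricted_mean_sq_error\<close>). Both halves of the theorem come from this one
  computation: with \<open>Q\<close> the whole space it gives the first, with arbitrary \<open>Q\<close> the second.
\<close>

section \<open>Adjoints, unitary matrices and the spectral theorem\<close>

lemma mat_adjoint_dim [simp]:
  "dim_row (mat_adjoint A) = dim_col A" "dim_col (mat_adjoint A) = dim_row A"
  by (auto simp: mat_adjoint_def)

lemma mat_adjoint_carrier [simp, intro]:
  "A \<in> carrier_mat n m \<Longrightarrow> mat_adjoint A \<in> carrier_mat m n"
  by (auto intro!: carrier_matI)

lemma mat_adjoint_index [simp]:
  fixes A :: "complex mat"
  assumes "i < dim_col A" "j < dim_row A"
  shows "mat_adjoint A $$ (i, j) = cnj (A $$ (j, i))"
  using assms by (simp add: mat_adjoint_def mat_of_rows_def)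

lemma mat_mult_index:
  fixes A B :: "complex mat"
  assumes "i < dim_row A" "j < dim_col B" "dim_col A = dim_row B"
  shows "(A * B) $$ (i, j) = (\<Sum>k<dim_row B. A $$ (i, k) * B $$ (k, j))"
  using assms by (simp add: scalar_prod_def lessThan_atLeast0)

lemma mat_adjoint_adjoint [simp]: "mat_adjoint (mat_adjoint (A :: complex mat)) = A"
  by (rule eq_matI) auto

text \<open>
  Associativity and the adjoint of a product, with the side conditions on dimensions rather than on
  carriers: the simplifier can then use them without guessing the inner dimension.
\<close>

lemma mat_mult_assoc:
  fixes A B C :: "complex mat"
  assumes "dim_col A = dim_row B" "dim_col B = dim_row C"
  shows "(A * B) * C = A * (B * C)"
  by (rule assoc_mult_mat[OF carrier_matI carrier_matI carrier_matI]) (use assms in auto)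

lemma mat_adjoint_mult:
  fixes A B :: "complex mat"
  assumes "dim_col A = dim_row B"
  shows "mat_adjoint (A * B) = mat_adjoint B * mat_adjoint A"
proof (rule eq_matI)
  fix i j assume "i < dim_row (mat_adjoint B * mat_adjoint A)" "j < dim_col (mat_adjoint B * mat_adjoint A)"
  with assms show "mat_adjoint (A * B) $$ (i, j) = (mat_adjoint B * mat_adjoint A) $$ (i, j)"
    by (simp add: mat_mult_index mult.commute del: index_mult_mat(1))
qed (use assms in auto)

lemma mat_diag_dims [simp]: "dim_row (mat_diag n f) = n" "dim_col (mat_diag n f) = n"
  by (auto simp: mat_diag_def)

lemma mat_adjoint_diag_real:
  "mat_adjoint (mat_diag n (\<lambda>i. complex_of_real (b i))) = mat_diag n (\<lambda>i. complex_of_real (b i))"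
  by (rule eq_matI) (auto simp: mat_diag_def)

lemma mat_adjoint_one [simp]: "mat_adjoint (1\<^sub>m n :: complex mat) = 1\<^sub>m n"
  by (rule eq_matI) auto

definition is_unitary :: "nat \<Rightarrow> complex mat \<Rightarrow> bool" where
  "is_unitary n U \<longleftrightarrow> U \<in> carrier_mat n n \<and> mat_adjoint U * U = 1\<^sub>m n \<and> U * mat_adjoint U = 1\<^sub>m n"

lemma is_unitaryI:
  assumes "U \<in> carrier_mat n n" "mat_adjoint U * U = 1\<^sub>m n"
  shows "is_unitary n U"
  using assms mat_mult_left_right_inverse[of "mat_adjoint U" n U] by (auto simp: is_unitary_def)

lemma is_unitary_mult:
  assumes "is_unitary n U" "is_unitary n V"
  shows "is_unitary n (U * V)"
proof (rule is_unitaryI)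
  have c: "U \<in> carrier_mat n n" "V \<in> carrier_mat n n" using assms by (auto simp: is_unitary_def)
  then show "U * V \<in> carrier_mat n n" by auto
  have "mat_adjoint U * (U * V) = (mat_adjoint U * U) * V"
    using c by (subst mat_mult_assoc) auto
  then have "mat_adjoint U * (U * V) = V"
    using assms c by (simp add: is_unitary_def)
  then show "mat_adjoint (U * V) * (U * V) = 1\<^sub>m n"
    using assms c by (simp add: mat_adjoint_mult mat_mult_assoc is_unitary_def)
qed

lemma cscalar_prod_self:
  fixes v :: "complex Matrix.vec"
  shows "v \<bullet>c v = complex_of_real (\<Sum>i<dim_vec v. (cmod (v $ i))\<^sup>2)"
  by (simp add: scalar_prod_def lessThan_atLeast0 complex_norm_square del: of_real_power)

text \<open>
  The induction step of the spectral theorem needs an eigenvector as the first column of a unitary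
  matrix. Gram--Schmidt, applied to a basis that begins with the eigenvector, leaves its first
  vector alone and yields orthogonal columns; dividing by their norms makes the matrix unitary.
\<close>

lemma unitary_with_first_column_eigenvector:
  fixes A :: "complex mat"
  assumes A: "A \<in> carrier_mat (Suc m) (Suc m)"
  obtains U e where "is_unitary (Suc m) U" "A *\<^sub>v col U 0 = e \<cdot>\<^sub>v col U 0"
proof -
  let ?n = "Suc m"
  interpret cof_vec_space ?n "TYPE(complex)" .
  obtain as where as: "char_poly A = (\<Prod>a\<leftarrow>as. [:- a, 1:])" "length as = ?n"
    using char_poly_factorized[OF A] by blast
  then obtain e where "e \<in> set as" by (cases as) auto
  then have "eigenvalue A e"
    unfolding eigenvalue_root_char_poly[OF A] as(1) by (auto simp: poly_prod_list prod_list_zero_iff)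
  then obtain v where "eigenvector A v e" unfolding eigenvalue_def by blast
  then have v: "v \<in> carrier_vec ?n" "v \<noteq> 0\<^sub>v ?n" "A *\<^sub>v v = e \<cdot>\<^sub>v v"
    using A by (auto simp: eigenvector_def)
  define b where "b = basis_completion v"
  define ws where "ws = gram_schmidt ?n b"
  note bc = basis_completion[OF v(1,2), folded b_def]
  note gs = gram_schmidt_result[OF bc(2,4,5) ws_def]
  obtain vs where "b = v # vs" using bc(6,7) by (cases b) auto
  then have "hd ws = v" using gram_schmidt_hd[OF v(1)] by (simp add: ws_def)
  moreover have len: "length ws = ?n" using gs(4) bc(6) by simp
  ultimately have ws0: "ws ! 0 = v" by (cases ws) auto
  have wsc: "ws ! i \<in> carrier_vec ?n" if "i < ?n" for i using gs(3) len that by auto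
  define r where "r i = (\<Sum>k<?n. (cmod (ws ! i $ k))\<^sup>2)" for i
  have self: "ws ! i \<bullet>c ws ! i = complex_of_real (r i)" if "i < ?n" for i
    unfolding r_def using cscalar_prod_self[of "ws ! i"] wsc[OF that] by simp
  have r: "r i > 0" if "i < ?n" for i
  proof -
    have "r i \<noteq> 0" using corthogonalD[OF gs(2), of i i] self[OF that] that len by auto
    moreover have "r i \<ge> 0" unfolding r_def by (intro sum_nonneg) auto
    ultimately show ?thesis by simp
  qed
  define U where "U = Matrix.mat ?n ?n (\<lambda>(k, i). ws ! i $ k / complex_of_real (sqrt (r i)))"
  have Uc: "U \<in> carrier_mat ?n ?n" by (simp add: U_def)
  have "mat_adjoint U * U = 1\<^sub>m ?n"
  proof (rule eq_matI)
    fix i j assume "i < dim_row (1\<^sub>m ?n :: complex mat)" "j < dim_col (1\<^sub>m ?n :: complex mat)"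
    then have ij: "i < ?n" "j < ?n" by auto
    have "(mat_adjoint U * U) $$ (i, j) =
        (\<Sum>k<?n. cnj (ws ! i $ k) * ws ! j $ k) / (complex_of_real (sqrt (r i)) * complex_of_real (sqrt (r j)))"
      using ij Uc by (subst mat_mult_index) (auto simp: U_def sum_divide_distrib simp del: sum.lessThan_Suc)
    also have "(\<Sum>k<?n. cnj (ws ! i $ k) * ws ! j $ k) = ws ! j \<bullet>c ws ! i"
      using wsc[OF ij(1), THEN carrier_vecD]
      by (auto simp: scalar_prod_def lessThan_atLeast0 intro!: sum.cong)
    also have "\<dots> / (complex_of_real (sqrt (r i)) * complex_of_real (sqrt (r j))) = (if i = j then 1 else 0)"
    proof (cases "i = j")
      case True
      have "complex_of_real (sqrt (r i)) * complex_of_real (sqrt (r i)) = complex_of_real (r i)"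
        using r[OF ij(1)] by (simp flip: of_real_mult)
      then show ?thesis using True self[OF ij(1)] r[OF ij(1)] by simp
    next
      case False
      then show ?thesis using corthogonalD[OF gs(2), of j i] ij len by simp
    qed
    finally show "(mat_adjoint U * U) $$ (i, j) = 1\<^sub>m ?n $$ (i, j)" using ij by simp
  qed (use Uc in auto)
  then have "is_unitary ?n U" using Uc by (rule is_unitaryI[rotated])
  moreover have "col U 0 = (1 / complex_of_real (sqrt (r 0))) \<cdot>\<^sub>v v"
    using v(1) by (intro eq_vecI) (auto simp: U_def ws0)
  then have "A *\<^sub>v col U 0 = e \<cdot>\<^sub>v col U 0"
    using v A by (simp add: mult_mat_vec[of A ?n ?n] smult_smult_assoc mult.commute)
  ultimately show ?thesis by (rule that)
qed

text \<open>
  The spectral theorem. Conjugating by the unitary matrix of the previous lemma clears the first column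
  except for its diagonal entry. The result is still Hermitian, so the first row is cleared as
  well and the remaining block is Hermitian of smaller size.
\<close>

theorem hermitian_unitary_diagonalization:
  fixes A :: "complex mat"
  assumes "A \<in> carrier_mat n n" "mat_adjoint A = A"
  shows "\<exists>U b. is_unitary n U \<and> A = U * mat_diag n (\<lambda>i. complex_of_real (b i)) * mat_adjoint U"
  using assms
proof (induction n arbitrary: A)
  case 0
  have "is_unitary 0 (1\<^sub>m 0)" by (simp add: is_unitary_def)
  moreover have "A = 1\<^sub>m 0 * mat_diag 0 (\<lambda>i. complex_of_real (0 :: real)) * mat_adjoint (1\<^sub>m 0)"
    using 0 by (intro eq_matI) auto
  ultimately show ?case by (intro exI conjI)
next
  case (Suc m)
  let ?n = "Suc m"
  note A = Suc.prems(1)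
  obtain W e where W: "is_unitary ?n W" and ev: "A *\<^sub>v col W 0 = e \<cdot>\<^sub>v col W 0"
    using unitary_with_first_column_eigenvector[OF A] .
  have Wc: "W \<in> carrier_mat ?n ?n" and WW: "mat_adjoint W * W = 1\<^sub>m ?n" "W * mat_adjoint W = 1\<^sub>m ?n"
    using W by (auto simp: is_unitary_def)
  define B where "B = mat_adjoint W * (A * W)"
  have Bc: "B \<in> carrier_mat ?n ?n" using A Wc by (auto simp: B_def)
  have Bh: "mat_adjoint B = B"
    using A Wc Suc.prems(2)
    by (simp add: B_def mat_adjoint_mult mat_mult_assoc)
  have B_herm: "B $$ (i, j) = cnj (B $$ (j, i))" if "i < ?n" "j < ?n" for i j
    using Bc that by (subst Bh[symmetric]) simp
  have Bcol: "B $$ (i, 0) = (if i = 0 then e else 0)" if "i < ?n" for i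
  proof -
    have "(A * W) $$ (k, 0) = e * W $$ (k, 0)" if "k < ?n" for k
      using arg_cong[OF ev, of "\<lambda>v. v $ k"] that A Wc by simp
    moreover have "B $$ (i, 0) = (\<Sum>k<?n. mat_adjoint W $$ (i, k) * (A * W) $$ (k, 0))"
      using A Wc that unfolding B_def by (subst mat_mult_index) auto
    ultimately have "B $$ (i, 0) = (\<Sum>k<?n. e * (mat_adjoint W $$ (i, k) * W $$ (k, 0)))"
      by (auto intro!: sum.cong)
    also have "\<dots> = e * (mat_adjoint W * W) $$ (i, 0)"
      using Wc that by (subst mat_mult_index) (auto simp only: sum_distrib_left mat_adjoint_dim carrier_matD)
    finally show ?thesis using WW that by simp
  qed
  define B' where "B' = Matrix.mat m m (\<lambda>(i, j). B $$ (Suc i, Suc j))"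
  have B': "B' \<in> carrier_mat m m" "mat_adjoint B' = B'"
    by (auto simp: B'_def intro!: eq_matI B_herm[symmetric])
  obtain V b where V: "is_unitary m V" and BV: "B' = V * mat_diag m (\<lambda>i. complex_of_real (b i)) * mat_adjoint V"
    using Suc.IH[OF B'] by blast
  have Vc: "V \<in> carrier_mat m m" and VV: "mat_adjoint V * V = 1\<^sub>m m"
    using V by (auto simp: is_unitary_def)
  \<comment> \<open>The unitary matrix of the smaller block, bordered by a 1 in the upper left corner.\<close>
  define V1 where "V1 = Matrix.mat ?n ?n (\<lambda>(i, j). if i = 0 \<and> j = 0 then 1
      else if i = 0 \<or> j = 0 then 0 else V $$ (i - 1, j - 1))"
  define b1 where "b1 i = (if i = 0 then Re e else b (i - 1))" for i
  let ?D1 = "mat_diag ?n (\<lambda>i. complex_of_real (b1 i))"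
  have V1c: "V1 \<in> carrier_mat ?n ?n" by (simp add: V1_def)
  have e_real: "complex_of_real (Re e) = e"
    using B_herm[of 0 0] Bcol[of 0] by (simp add: complex_eq_iff)
  have V1: "is_unitary ?n V1"
  proof (rule is_unitaryI[OF V1c], rule eq_matI)
    fix i j assume ij: "i < dim_row (1\<^sub>m ?n :: complex mat)" "j < dim_col (1\<^sub>m ?n :: complex mat)"
    have "(mat_adjoint V * V) $$ (i - 1, j - 1) = (if i = j then 1 else 0)" if "i \<noteq> 0" "j \<noteq> 0"
      using ij that by (auto simp: VV)
    then show "(mat_adjoint V1 * V1) $$ (i, j) = 1\<^sub>m ?n $$ (i, j)"
      using ij V1c Vc by (cases i; cases j)
        (simp_all add: mat_mult_index V1_def sum.lessThan_Suc_shift del: index_mult_mat(1) sum.lessThan_Suc)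
  qed (use V1c in auto)
  have "B = V1 * ?D1 * mat_adjoint V1"
  proof (rule eq_matI)
    fix i j assume "i < dim_row (V1 * ?D1 * mat_adjoint V1)" "j < dim_col (V1 * ?D1 * mat_adjoint V1)"
    then have ij: "i < ?n" "j < ?n" using V1c by auto
    have r: "(V1 * ?D1 * mat_adjoint V1) $$ (i, j) = (\<Sum>k<?n. V1 $$ (i, k) * b1 k * cnj (V1 $$ (j, k)))"
      using ij V1c by (subst mat_mult_index) (auto simp: mat_diag_mult_right[OF V1c])
    have B'r: "B' $$ (i', j') = (\<Sum>k<m. V $$ (i', k) * b k * cnj (V $$ (j', k)))" if "i' < m" "j' < m" for i' j'
      using that Vc unfolding BV by (subst mat_mult_index) (auto simp: mat_diag_mult_right[OF Vc])
    show "B $$ (i, j) = (V1 * ?D1 * mat_adjoint V1) $$ (i, j)"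
    proof (cases "i = 0 \<or> j = 0")
      case True
      then show ?thesis unfolding r using ij Bcol[of i] Bcol[of j] B_herm[of i j] e_real
        by (cases i; cases j) (simp_all add: V1_def b1_def sum.lessThan_Suc_shift del: sum.lessThan_Suc)
    next
      case False
      then have "B $$ (i, j) = B' $$ (i - 1, j - 1)" using ij by (cases i; cases j) (auto simp: B'_def)
      also have "\<dots> = (\<Sum>k<m. V $$ (i - 1, k) * b k * cnj (V $$ (j - 1, k)))"
        using False ij by (intro B'r) auto
      finally show ?thesis unfolding r using ij False
        by (simp add: V1_def b1_def sum.lessThan_Suc_shift del: sum.lessThan_Suc)
    qed
  qed (use Bc V1c in auto)
  moreover have "A = W * B * mat_adjoint W"
  proof -
    have "W * B * mat_adjoint W = (W * mat_adjoint W) * A * (W * mat_adjoint W)"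
      using A Wc by (simp add: B_def mat_mult_assoc)
    then show ?thesis using A WW by simp
  qed
  ultimately have "A = (W * V1) * ?D1 * mat_adjoint (W * V1)"
    using Wc V1c by (simp add: mat_adjoint_mult mat_mult_assoc)
  then show ?case using is_unitary_mult[OF W V1] by blast
qed

section \<open>Trace and Frobenius norm\<close>

definition mtrace :: "complex mat \<Rightarrow> complex" where
  "mtrace A = (\<Sum>i<dim_row A. A $$ (i, i))"

definition frobenius2 :: "complex mat \<Rightarrow> real" where
  "frobenius2 A = (\<Sum>i<dim_row A. \<Sum>j<dim_col A. (cmod (A $$ (i, j)))\<^sup>2)"

lemma mtrace_mult:
  assumes "A \<in> carrier_mat n m" "B \<in> carrier_mat m n"
  shows "mtrace (A * B) = (\<Sum>i<n. \<Sum>k<m. A $$ (i, k) * B $$ (k, i))"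
  using assms by (simp add: mtrace_def mat_mult_index del: index_mult_mat(1))

lemma mtrace_mult_comm:
  assumes "A \<in> carrier_mat n m" "B \<in> carrier_mat m n"
  shows "mtrace (A * B) = mtrace (B * A)"
  unfolding mtrace_mult[OF assms] mtrace_mult[OF assms(2,1)]
  by (subst sum.swap) (simp add: mult.commute)

lemma frobenius2_eq_mtrace: "complex_of_real (frobenius2 A) = mtrace (mat_adjoint A * A)"
proof -
  have "mtrace (mat_adjoint A * A) = mtrace (A * mat_adjoint A)"
    by (rule mtrace_mult_comm) auto
  also have "\<dots> = (\<Sum>i<dim_row A. \<Sum>j<dim_col A. A $$ (i, j) * mat_adjoint A $$ (j, i))"
    by (rule mtrace_mult) auto
  also have "\<dots> = complex_of_real (frobenius2 A)"
    by (simp add: frobenius2_def complex_norm_square del: of_real_power)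
  finally show ?thesis by simp
qed

text \<open>
  The diagonal entries of \<open>A A\<^sup>*\<close> are the squared norms of the rows of \<open>A\<close>.
\<close>

lemma mat_eq_0_if_gram_eq_0:
  fixes A :: "complex mat"
  assumes "A \<in> carrier_mat n m" "A * mat_adjoint A = 0\<^sub>m n n"
  shows "A = 0\<^sub>m n m"
proof (rule eq_matI)
  fix i j assume "i < dim_row (0\<^sub>m n m :: complex mat)" "j < dim_col (0\<^sub>m n m :: complex mat)"
  then have ij: "i < n" "j < m" by auto
  have "(\<Sum>k<m. A $$ (i, k) * mat_adjoint A $$ (k, i)) = (A * mat_adjoint A) $$ (i, i)"
    using assms(1) ij by (subst mat_mult_index) auto
  then have "complex_of_real (\<Sum>k<m. (cmod (A $$ (i, k)))\<^sup>2) = 0"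
    using assms ij by (simp add: complex_norm_square del: of_real_power)
  then have "(\<Sum>k<m. (cmod (A $$ (i, k)))\<^sup>2) = 0" by (simp only: of_real_eq_0_iff)
  then have "(cmod (A $$ (i, j)))\<^sup>2 = 0" using ij by (subst (asm) sum_nonneg_eq_0_iff) auto
  then show "A $$ (i, j) = 0\<^sub>m n m $$ (i, j)" using ij by simp
qed (use assms in auto)

section \<open>Functions of a Hermitian matrix\<close>

text \<open>
  The functional calculus in a fixed orthonormal basis: the Hermitian matrix with eigenvalue \<open>f i\<close>
  on column \<open>i\<close> of \<open>U\<close>. Products and complements to the identity become pointwise operations on
  \<open>f\<close>, and the trace becomes the sum of \<open>f\<close>.
\<close>

definition spectral :: "nat \<Rightarrow> complex mat \<Rightarrow> (nat \<Rightarrow> real) \<Rightarrow> complex mat" where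
  "spectral n U f = U * mat_diag n (\<lambda>i. complex_of_real (f i)) * mat_adjoint U"

context
  fixes n :: nat and U :: "complex mat"
  assumes U: "is_unitary n U"
begin

private lemma Uc: "U \<in> carrier_mat n n" "mat_adjoint U * U = 1\<^sub>m n" "U * mat_adjoint U = 1\<^sub>m n"
  using U by (auto simp: is_unitary_def)

lemma spectral_dims [simp]:
  "dim_row (spectral n U f) = n" "dim_col (spectral n U f) = n"
  using Uc(1) by (auto simp: spectral_def)

lemma spectral_carrier: "spectral n U f \<in> carrier_mat n n"
  using Uc(1) by (auto simp: spectral_def)

lemma spectral_mult: "spectral n U f * spectral n U g = spectral n U (\<lambda>i. f i * g i)"
proof -
  let ?D = "\<lambda>f. mat_diag n (\<lambda>i. complex_of_real (f i))"
  have "spectral n U f * spectral n U g = U * (?D f * ((mat_adjoint U * U) * (?D g * mat_adjoint U)))"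
    using Uc(1) by (simp add: spectral_def mat_mult_assoc)
  also have "\<dots> = U * (?D f * (?D g * mat_adjoint U))" using Uc by simp
  also have "\<dots> = U * ((?D f * ?D g) * mat_adjoint U)"
    using Uc(1) by (subst assoc_mult_mat[of "?D f" n n "?D g" n]) auto
  finally show ?thesis using Uc(1) by (simp add: spectral_def mat_mult_assoc)
qed

lemma spectral_adjoint: "mat_adjoint (spectral n U f) = spectral n U f"
  using Uc(1) by (simp add: spectral_def mat_adjoint_mult mat_adjoint_diag_real mat_mult_assoc)

lemma spectral_trace: "mtrace (spectral n U f) = of_real (\<Sum>i<n. f i)"
proof -
  let ?D = "mat_diag n (\<lambda>i. complex_of_real (f i))"
  have "mtrace (spectral n U f) = mtrace (mat_adjoint U * (U * ?D))"
    unfolding spectral_def using Uc(1) by (intro mtrace_mult_comm) auto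
  also have "mat_adjoint U * (U * ?D) = (mat_adjoint U * U) * ?D"
    using Uc(1) by (subst assoc_mult_mat[of _ n n _ n _ n]) auto
  also have "\<dots> = ?D" using Uc by simp
  also have "mtrace ?D = of_real (\<Sum>i<n. f i)" by (simp add: mtrace_def mat_diag_def)
  finally show ?thesis .
qed

lemma one_minus_spectral: "1\<^sub>m n - spectral n U f = spectral n U (\<lambda>i. 1 - f i)"
proof -
  let ?D = "\<lambda>f. mat_diag n (\<lambda>i. complex_of_real (f i))"
  have "?D (\<lambda>i. 1 - f i) = 1\<^sub>m n - ?D f"
    by (rule eq_matI) (auto simp: mat_diag_def)
  then show ?thesis using Uc
    by (simp add: spectral_def mult_minus_distrib_mat[of _ n n _ n] minus_mult_distrib_mat[of _ n n _ _ n])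
qed

lemma proots_char_poly_spectral:
  "proots (char_poly (spectral n U f)) = image_mset (\<lambda>i. complex_of_real (f i)) (mset_set {..<n})"
proof -
  let ?D = "mat_diag n (\<lambda>i. complex_of_real (f i))"
  have "similar_mat (spectral n U f) ?D"
    using Uc spectral_carrier by (intro similar_matI[of _ _ U "mat_adjoint U" n]) (auto simp: spectral_def)
  then have "char_poly (spectral n U f) = char_poly ?D" by (rule char_poly_similar)
  also have "\<dots> = (\<Prod>a\<leftarrow>diag_mat ?D. [:- a, 1:])"
    by (rule char_poly_upper_triangular[of _ n]) (auto simp: mat_diag_def)
  also have "diag_mat ?D = map (\<lambda>i. complex_of_real (f i)) [0..<n]"
    by (auto simp: diag_mat_def mat_diag_def)
  also have "(\<Prod>a\<leftarrow>map (\<lambda>i. complex_of_real (f i)) [0..<n]. [:- a, 1:]) = (\<Prod>p\<leftarrow>map (\<lambda>i. [:- complex_of_real (f i), 1:]) [0..<n]. p)"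
    by (simp add: o_def)
  also have "proots \<dots> = (\<Sum>p\<leftarrow>map (\<lambda>i. [:- complex_of_real (f i), 1:]) [0..<n]. proots p)"
    by (rule proots_prod_list) auto
  also have "\<dots> = mset (map (\<lambda>i. complex_of_real (f i)) [0..<n])"
    by (simp add: o_def)
  also have "\<dots> = image_mset (\<lambda>i. complex_of_real (f i)) (mset_set {..<n})"
    by (simp add: lessThan_atLeast0 flip: mset_set_set)
  finally show ?thesis .
qed

end

section \<open>The Moore--Penrose inverse\<close>

text \<open>
  The products \<open>A X\<close> and \<open>X A\<close> are Hermitian idempotents that \<open>A\<close> alone determines; each is shown to
  agree for two pseudoinverses by taking adjoints in \<open>A Y A X\<close> and in \<open>X A Y A\<close>. Then
  \<open>X = X A X = X A Y = Y A Y = Y\<close>.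
\<close>

lemma is_pseudoinverse_unique:
  assumes X: "is_pseudoinverse A X" and Y: "is_pseudoinverse A Y"
  shows "X = Y"
proof -
  define n m where "n = dim_row A" and "m = dim_col A"
  have c: "A \<in> carrier_mat n m" "X \<in> carrier_mat m n" "Y \<in> carrier_mat m n"
    using X Y by (auto simp: is_pseudoinverse_def n_def m_def)
  have AX: "A * X * A = A" "X * A * X = X" "mat_adjoint (A * X) = A * X" "mat_adjoint (X * A) = X * A"
    using X by (auto simp: is_pseudoinverse_def)
  have AY: "A * Y * A = A" "Y * A * Y = Y" "mat_adjoint (A * Y) = A * Y" "mat_adjoint (Y * A) = Y * A"
    using Y by (auto simp: is_pseudoinverse_def)
  have "A * X = mat_adjoint ((A * Y * A) * X)" using AX AY by simp
  also have "(A * Y * A) * X = (A * Y) * (A * X)"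
    using c by (subst assoc_mult_mat[of "A * Y" n n A m X n]) auto
  also have "mat_adjoint \<dots> = mat_adjoint (A * X) * mat_adjoint (A * Y)"
    using c by (intro mat_adjoint_mult) auto
  also have "\<dots> = (A * X * A) * Y"
    unfolding AX(3) AY(3) using c by (subst assoc_mult_mat[of "A * X" n n A m Y n]) auto
  also have "\<dots> = A * Y" using AX by simp
  finally have 1: "A * X = A * Y" .
  have "X * A = mat_adjoint (X * (A * Y * A))" using AX AY by simp
  also have "X * (A * Y * A) = (X * A) * (Y * A)"
    using c by (simp add: mat_mult_assoc)
  also have "mat_adjoint \<dots> = mat_adjoint (Y * A) * mat_adjoint (X * A)"
    using c by (intro mat_adjoint_mult) auto
  also have "\<dots> = Y * (A * X * A)"
    unfolding AX(4) AY(4)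
    using c by (simp add: mat_mult_assoc)
  also have "\<dots> = Y * A" using AX by simp
  finally have 2: "X * A = Y * A" .
  have "X = X * (A * X)" using AX(2) c by (simp add: mat_mult_assoc)
  also have "\<dots> = (X * A) * Y" using c by (simp add: 1 mat_mult_assoc)
  also have "\<dots> = Y" using AY(2) 2 by simp
  finally show ?thesis .
qed

text \<open>
  The eigenvalues of \<open>A A\<^sup>*\<close> are nonnegative because they are the squared norms of the rows of
  \<open>U\<^sup>* A\<close>.
\<close>

lemma gram_spectral_decomposition:
  fixes A :: "complex mat"
  assumes A: "A \<in> carrier_mat n m"
  obtains U b where "is_unitary n U" "A * mat_adjoint A = spectral n U b" "\<And>i. i < n \<Longrightarrow> b i \<ge> 0"
proof -
  have "mat_adjoint (A * mat_adjoint A) = A * mat_adjoint A"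
    using A by (simp add: mat_adjoint_mult)
  moreover have "A * mat_adjoint A \<in> carrier_mat n n" using A by auto
  ultimately obtain U b where U: "is_unitary n U" and eq: "A * mat_adjoint A = spectral n U b"
    unfolding spectral_def using hermitian_unitary_diagonalization by blast
  have Uc: "U \<in> carrier_mat n n" "mat_adjoint U * U = 1\<^sub>m n" using U by (auto simp: is_unitary_def)
  have "b i \<ge> 0" if i: "i < n" for i
  proof -
    define C where "C = mat_adjoint U * A"
    let ?D = "mat_diag n (\<lambda>i. complex_of_real (b i))"
    have Cc: "C \<in> carrier_mat n m" using Uc A by (auto simp: C_def)
    have "C * mat_adjoint C = mat_adjoint U * ((A * mat_adjoint A) * U)"
      using Uc(1) A by (simp add: C_def mat_adjoint_mult mat_mult_assoc)
    also have "\<dots> = (mat_adjoint U * U) * (?D * (mat_adjoint U * U))"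
      unfolding eq spectral_def using Uc(1) by (simp add: mat_mult_assoc)
    also have "\<dots> = ?D" using Uc by simp
    finally have "(C * mat_adjoint C) $$ (i, i) = complex_of_real (b i)" using i by (simp add: mat_diag_def)
    moreover have "(C * mat_adjoint C) $$ (i, i) = (\<Sum>k<m. C $$ (i, k) * mat_adjoint C $$ (k, i))"
      using Cc i by (subst mat_mult_index) auto
    moreover have "\<dots> = complex_of_real (\<Sum>k<m. (cmod (C $$ (i, k)))\<^sup>2)"
      using Cc i by (simp add: complex_norm_square del: of_real_power)
    ultimately have "b i = (\<Sum>k<m. (cmod (C $$ (i, k)))\<^sup>2)" using of_real_eq_iff by metis
    then show "b i \<ge> 0" by (simp add: sum_nonneg)
  qed
  with U eq show ?thesis using that by blast
qed

text \<open>
  For \<open>A A\<^sup>* = spectral n U b\<close> the pseudoinverse is \<open>A\<^sup>*\<close> times the same spectral matrix with each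
  eigenvalue inverted. Since \<open>inverse 0 = 0\<close>, the kernel of \<open>A\<^sup>*\<close> needs no separate treatment, and
  \<open>b i * inverse (b i)\<close> is the indicator of \<open>b i \<noteq> 0\<close>.
\<close>

context
  fixes A U :: "complex mat" and n m :: nat and b :: "nat \<Rightarrow> real"
  assumes A: "A \<in> carrier_mat n m" and U: "is_unitary n U"
    and gram: "A * mat_adjoint A = spectral n U b"
begin

private abbreviation "P \<equiv> spectral n U (\<lambda>i. b i * inverse (b i))"
private abbreviation "X \<equiv> mat_adjoint A * spectral n U (\<lambda>i. inverse (b i))"

private lemma Xc: "X \<in> carrier_mat m n" using A spectral_carrier[OF U] by (intro mult_carrier_mat[of _ m n]) auto

private lemma adjoint_X: "mat_adjoint X = spectral n U (\<lambda>i. inverse (b i)) * A"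
proof -
  have "mat_adjoint X = mat_adjoint (spectral n U (\<lambda>i. inverse (b i))) * mat_adjoint (mat_adjoint A)"
    using A spectral_dims[OF U] by (intro mat_adjoint_mult) auto
  then show ?thesis by (simp only: spectral_adjoint[OF U] mat_adjoint_adjoint)
qed

lemma gram_mult_pseudoinverse: "A * X = P"
proof -
  have "A * X = (A * mat_adjoint A) * spectral n U (\<lambda>i. inverse (b i))"
    using A spectral_carrier[OF U] by (subst assoc_mult_mat[of A n m "mat_adjoint A" n]) auto
  then show ?thesis by (simp add: gram spectral_mult[OF U])
qed

text \<open>
  \<open>P\<close> fixes \<open>A A\<^sup>*\<close>, so \<open>R = P A - A\<close> has \<open>R R\<^sup>* = 0\<close>.
\<close>

lemma gram_projection_mult: "P * A = A"
proof -
  note [simp] = spectral_carrier[OF U]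
  note c = A
  define R where "R = P * A - A"
  have Rc: "R \<in> carrier_mat n m" using c by (auto simp: R_def)
  have PG: "P * spectral n U b = spectral n U b"
    unfolding spectral_mult[OF U] by (rule arg_cong[of _ _ "spectral n U"]) (auto simp: field_simps)
  have "R = (P - 1\<^sub>m n) * A" unfolding R_def using c by (subst minus_mult_distrib_mat[of _ n n _ _ m]) auto
  then have "R * mat_adjoint R = (P - 1\<^sub>m n) * (A * mat_adjoint R)"
    using c Rc by (simp add: mat_mult_assoc)
  moreover have "mat_adjoint R = mat_adjoint A * mat_adjoint (P - 1\<^sub>m n)"
    unfolding \<open>R = (P - 1\<^sub>m n) * A\<close> using c by (intro mat_adjoint_mult) auto
  ultimately have "R * mat_adjoint R = ((P - 1\<^sub>m n) * (A * mat_adjoint A)) * mat_adjoint (P - 1\<^sub>m n)"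
    using c by (simp add: mat_mult_assoc)
  also have "(P - 1\<^sub>m n) * (A * mat_adjoint A) = 0\<^sub>m n n"
    unfolding gram using PG left_mult_one_mat[OF spectral_carrier[OF U, of b]]
    by (subst minus_mult_distrib_mat[of _ n n _ _ n]) (auto simp: minus_r_inv_mat)
  finally have "R * mat_adjoint R = 0\<^sub>m n n" using c by simp
  then have "R = 0\<^sub>m n m" by (rule mat_eq_0_if_gram_eq_0[OF Rc])
  then have R0: "(P * A - A) $$ (i, j) = 0" if "i < n" "j < m" for i j using that by (simp add: R_def)
  show ?thesis
  proof (rule eq_matI)
    fix i j assume "i < dim_row A" "j < dim_col A"
    then show "(P * A) $$ (i, j) = A $$ (i, j)" using R0[of i j] c by simp
  qed (use c spectral_dims[OF U] in auto)
qed

lemma pseudoinverse_eq: "pseudoinverse A = X"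
proof -
  note [simp] = spectral_carrier[OF U]
  note c = A Xc
  have "X * P = mat_adjoint A * (spectral n U (\<lambda>i. inverse (b i)) * P)"
    using c by (intro assoc_mult_mat[of _ m n _ n _ n]) auto
  also have "\<dots> = X"
    unfolding spectral_mult[OF U]
    by (rule arg_cong[of _ _ "\<lambda>f. mat_adjoint A * spectral n U f"]) (auto simp: field_simps)
  finally have "X * P = X" .
  then have "X * A * X = X"
    using c gram_mult_pseudoinverse by (simp add: mat_mult_assoc)
  moreover have "mat_adjoint (X * A) = X * A"
  proof -
    have "mat_adjoint (X * A) = mat_adjoint A * mat_adjoint X"
      using c by (intro mat_adjoint_mult) auto
    also have "\<dots> = X * A"
      unfolding adjoint_X using c spectral_dims[OF U] by (intro mat_mult_assoc[symmetric]) auto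
    finally show ?thesis .
  qed
  ultimately have "is_pseudoinverse A X"
    using c unfolding is_pseudoinverse_def
    by (auto simp: gram_mult_pseudoinverse gram_projection_mult spectral_adjoint[OF U])
  then show ?thesis unfolding pseudoinverse_def
    using is_pseudoinverse_unique by (intro the_equality) auto
qed

lemma frobenius2_pseudoinverse: "frobenius2 (pseudoinverse A) = (\<Sum>i<n. inverse (b i))"
proof -
  note [simp] = spectral_carrier[OF U]
  note c = A Xc
  have "mat_adjoint X * X = spectral n U (\<lambda>i. inverse (b i)) * (A * X)"
    unfolding adjoint_X using c spectral_dims[OF U] by (intro mat_mult_assoc) auto
  also have "\<dots> = spectral n U (\<lambda>i. inverse (b i))"
    unfolding gram_mult_pseudoinverse spectral_mult[OF U]
    by (rule arg_cong[of _ _ "spectral n U"]) (auto simp: field_simps)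
  finally have "complex_of_real (frobenius2 X) = of_real (\<Sum>i<n. inverse (b i))"
    by (simp only: frobenius2_eq_mtrace spectral_trace[OF U])
  then show ?thesis by (simp only: pseudoinverse_eq of_real_eq_iff)
qed

text \<open>
  The columns of \<open>U\<close> with nonzero eigenvalue form a matrix \<open>B\<close> of full rank with the same column
  space as \<open>A\<close>: both \<open>B B\<^sup>*\<close> and \<open>A X\<close> are the projection \<open>P\<close>, and \<open>P\<close> fixes \<open>A\<close> and \<open>B\<close>.
\<close>

lemma rank_eq_card_nonzero_eigenvalues: "vec_space.rank n A = card {i. i < n \<and> b i \<noteq> 0}"
proof -
  interpret vec_space "TYPE(complex)" n .
  note [simp] = spectral_carrier[OF U]
  note c = A Xc
  have Uc: "U \<in> carrier_mat n n" "mat_adjoint U * U = 1\<^sub>m n" "U * mat_adjoint U = 1\<^sub>m n"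
    using U by (auto simp: is_unitary_def)
  define J where "J = filter (\<lambda>i. b i \<noteq> 0) [0..<n]"
  define k where "k = length J"
  define B where "B = mat_of_cols n (map (col U) J)"
  have J: "J ! i < n" "b (J ! i) \<noteq> 0" if "i < k" for i
    using nth_mem[of i J] that by (auto simp: J_def k_def)
  have distJ: "distinct J" by (simp add: J_def)
  have Bc: "B \<in> carrier_mat n k" using mat_of_cols_carrier(1)[of n "map (col U) J"] by (simp add: B_def k_def)
  have colsB: "cols B = map (col U) J" using Uc unfolding B_def by (intro cols_mat_of_cols) auto
  have "det U * det (mat_adjoint U) = 1"
    using Uc by (subst det_mult[symmetric, of U n]) auto
  then have "rank U = n" using Uc(1) low_rank_det_zero by force
  have distU: "distinct (cols U)"
    using non_distinct_low_rank[OF Uc(1)] \<open>rank U = n\<close> by auto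
  then have liU: "lin_indpt (set (cols U))" using full_rank_lin_indpt[OF Uc(1) \<open>rank U = n\<close>] by blast
  have sub: "set (cols B) \<subseteq> set (cols U)"
    unfolding colsB using Uc(1) by (auto simp: J_def cols_def)
  have "distinct (cols B)"
    unfolding colsB distinct_map
  proof (intro conjI distJ)
    have "inj_on (col U) (set [0..<n])" using distU Uc(1) unfolding cols_def distinct_map by simp
    then show "inj_on (col U) (set J)" by (rule inj_on_subset) (auto simp: J_def)
  qed
  moreover have "lin_indpt (set (cols B))" using subset_li_is_li[OF liU sub] .
  ultimately have "rank B = k" by (rule lin_indpt_full_rank[OF Bc])
  moreover have "span (set (cols A)) = span (set (cols B))"
  proof -
    have colA: "span (set (cols A)) = {y \<in> carrier_vec n. \<exists>x\<in>carrier_vec m. A *\<^sub>v x = y}"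
      using col_space_eq[OF A] c by (simp add: col_space_def)
    have colB: "span (set (cols B)) = {y \<in> carrier_vec n. \<exists>x\<in>carrier_vec k. B *\<^sub>v x = y}"
      using col_space_eq[OF Bc] Bc by (simp add: col_space_def)
    have AX_P: "A *\<^sub>v (X *\<^sub>v y) = P *\<^sub>v y" if "y \<in> carrier_vec n" for y
      using that c gram_mult_pseudoinverse by (simp flip: assoc_mult_mat_vec[of A n m X n])
    have PA: "P *\<^sub>v (A *\<^sub>v x) = A *\<^sub>v x" if "x \<in> carrier_vec m" for x
      using that c gram_projection_mult by (simp flip: assoc_mult_mat_vec[of P n n A m])
    have P_B: "P = B * mat_adjoint B"
    proof (rule eq_matI)
      fix i j assume "i < dim_row (B * mat_adjoint B)" "j < dim_col (B * mat_adjoint B)"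
      then have ij: "i < n" "j < n" using Bc by auto
      have "P $$ (i, j) = (\<Sum>l<n. U $$ (i, l) * complex_of_real (b l * inverse (b l)) * cnj (U $$ (j, l)))"
        unfolding spectral_def using Uc(1) ij
        by (subst mat_mult_index) (auto simp: mat_diag_mult_right[OF Uc(1)])
      also have "\<dots> = (\<Sum>l\<in>set J. U $$ (i, l) * cnj (U $$ (j, l)))"
        by (rule sum.mono_neutral_cong_right) (auto simp: J_def)
      also have "\<dots> = (\<Sum>t<k. U $$ (i, J ! t) * cnj (U $$ (j, J ! t)))"
        unfolding k_def using distJ
        by (simp add: sum.distinct_set_conv_list sum_list_sum_nth lessThan_atLeast0)
      also have "\<dots> = (B * mat_adjoint B) $$ (i, j)"
        using ij Bc Uc(1) J by (subst mat_mult_index)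
          (auto simp: B_def mat_of_cols_def k_def intro!: sum.cong)
      finally show "P $$ (i, j) = (B * mat_adjoint B) $$ (i, j)" .
    qed (simp_all add: carrier_matD[OF Bc] spectral_dims[OF U])
    have BB: "mat_adjoint B * B = 1\<^sub>m k"
    proof (rule eq_matI)
      fix i j assume "i < dim_row (1\<^sub>m k :: complex mat)" "j < dim_col (1\<^sub>m k :: complex mat)"
      then have ij: "i < k" "j < k" by auto
      have "(mat_adjoint B * B) $$ (i, j) = (mat_adjoint U * U) $$ (J ! i, J ! j)"
        using ij Bc Uc(1) J by (subst (1 2) mat_mult_index)
          (auto simp: B_def mat_of_cols_def k_def intro!: sum.cong)
      also have "\<dots> = (if i = j then 1 else 0)"
        using Uc(2) J[OF ij(1)] J[OF ij(2)] ij distJ by (simp add: k_def nth_eq_iff_index_eq)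
      finally show "(mat_adjoint B * B) $$ (i, j) = 1\<^sub>m k $$ (i, j)" using ij by simp
    qed (use Bc in auto)
    have PBx: "P *\<^sub>v (B *\<^sub>v x) = B *\<^sub>v x" if "x \<in> carrier_vec k" for x
    proof -
      have "P * B = B * (mat_adjoint B * B)" using Bc by (simp add: P_B mat_mult_assoc)
      then have "P * B = B" using Bc BB by simp
      then show ?thesis using that Bc c by (simp flip: assoc_mult_mat_vec[of P n n B k])
    qed
    have PB': "P *\<^sub>v y = B *\<^sub>v (mat_adjoint B *\<^sub>v y)" if "y \<in> carrier_vec n" for y
      using that Bc by (simp add: P_B assoc_mult_mat_vec[of B n k _ n])
    show ?thesis
    proof (intro equalityI subsetI)
      fix y assume "y \<in> span (set (cols A))"
      then obtain x where "x \<in> carrier_vec m" "y = A *\<^sub>v x" "y \<in> carrier_vec n" unfolding colA by auto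
      then have "B *\<^sub>v (mat_adjoint B *\<^sub>v y) = y" using PA PB' by metis
      then show "y \<in> span (set (cols B))" unfolding colB
        using \<open>y \<in> carrier_vec n\<close> mult_mat_vec_carrier[OF mat_adjoint_carrier[OF Bc], of y] by auto
    next
      fix y assume "y \<in> span (set (cols B))"
      then obtain x where "x \<in> carrier_vec k" "y = B *\<^sub>v x" "y \<in> carrier_vec n" unfolding colB by auto
      then have "y = A *\<^sub>v (X *\<^sub>v y)" using PBx AX_P by metis
      then show "y \<in> span (set (cols A))" unfolding colA using c \<open>y \<in> carrier_vec n\<close>
        by (auto intro!: bexI[of _ "X *\<^sub>v y"])
    qed
  qed
  ultimately have "rank A = k" by (simp add: rank_def)
  also have "k = card (set J)" using distJ by (simp add: k_def distinct_card)
  also have "set J = {i. i < n \<and> b i \<noteq> 0}" by (auto simp: J_def)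
  finally show ?thesis .
qed

lemma mtrace_mult_pseudoinverse: "mtrace (A * pseudoinverse A) = of_nat (vec_space.rank n A)"
proof -
  have "(\<Sum>i<n. b i * inverse (b i)) = (\<Sum>i\<in>{i. i < n \<and> b i \<noteq> 0}. 1)"
    by (rule sum.mono_neutral_cong_right) auto
  then show ?thesis
    by (simp add: pseudoinverse_eq gram_mult_pseudoinverse spectral_trace[OF U] rank_eq_card_nonzero_eigenvalues)
qed

end

lemma pseudoinverse_carrier:
  assumes "A \<in> carrier_mat n m"
  shows "pseudoinverse A \<in> carrier_mat m n"
proof -
  obtain U b where Ub: "is_unitary n U" "A * mat_adjoint A = spectral n U b"
    using gram_spectral_decomposition[OF assms] .
  show ?thesis unfolding pseudoinverse_eq[OF assms Ub]
    using spectral_carrier[OF Ub(1)] assms by (intro mult_carrier_mat[of _ m n]) auto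
qed

theorem mtrace_mult_pseudoinverse_eq_rank:
  assumes A: "A \<in> carrier_mat n m"
  shows "mtrace (A * pseudoinverse A) = of_nat (vec_space.rank n A)"
proof -
  obtain U b where Ub: "is_unitary n U" "A * mat_adjoint A = spectral n U b"
    using gram_spectral_decomposition[OF A] .
  then show ?thesis by (rule mtrace_mult_pseudoinverse[OF A])
qed

text \<open>
  The complement \<open>B B\<^sup>* = I - A A\<^sup>*\<close> is diagonal in the same basis, with eigenvalues \<open>1 - b i\<close>. The
  condition \<open>Re z < 1\<close> therefore selects exactly the nonzero \<open>b i\<close>.
\<close>

theorem frobenius2_pseudoinverse_complementary:
  assumes A: "A \<in> carrier_mat n m" and B: "B \<in> carrier_mat n k"
    and sum: "A * mat_adjoint A + B * mat_adjoint B = 1\<^sub>m n"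
  shows "frobenius2 (pseudoinverse A) =
    (\<Sum>z\<in>#proots (char_poly (B * mat_adjoint B)). if Re z < 1 then 1 / (1 - Re z) else 0)"
proof -
  obtain U b where U: "is_unitary n U" and gram: "A * mat_adjoint A = spectral n U b"
    and b: "\<And>i. i < n \<Longrightarrow> b i \<ge> 0"
    by (rule gram_spectral_decomposition[OF A], rule that)
  have "B * mat_adjoint B = 1\<^sub>m n - spectral n U b"
  proof (rule eq_matI)
    fix i j assume "i < dim_row (1\<^sub>m n - spectral n U b)" "j < dim_col (1\<^sub>m n - spectral n U b)"
    then have ij: "i < n" "j < n" using spectral_carrier[OF U, of b] by auto
    have "(A * mat_adjoint A + B * mat_adjoint B) $$ (i, j) = 1\<^sub>m n $$ (i, j)" by (simp only: sum)
    moreover have "(A * mat_adjoint A + B * mat_adjoint B) $$ (i, j) =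
        (A * mat_adjoint A) $$ (i, j) + (B * mat_adjoint B) $$ (i, j)"
      using ij A B by (intro index_add_mat(1)) auto
    ultimately show "(B * mat_adjoint B) $$ (i, j) = (1\<^sub>m n - spectral n U b) $$ (i, j)"
      using ij spectral_carrier[OF U, of b] unfolding gram by (simp add: algebra_simps del: index_mult_mat(1))
  qed (use A B spectral_carrier[OF U, of b] in auto)
  also have "\<dots> = spectral n U (\<lambda>i. 1 - b i)" by (rule one_minus_spectral[OF U])
  finally have "(\<Sum>z\<in>#proots (char_poly (B * mat_adjoint B)). if Re z < 1 then 1 / (1 - Re z) else 0) =
      (\<Sum>i<n. if 1 - b i < 1 then 1 / b i else 0)"
    by (simp add: proots_char_poly_spectral[OF U] image_mset.compositionality o_def sum_unfold_sum_mset cong: if_cong)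
  also have "\<dots> = (\<Sum>i<n. inverse (b i))"
    using b by (intro sum.cong) (auto simp: inverse_eq_divide less_le)
  finally show ?thesis using frobenius2_pseudoinverse[OF A U gram] by simp
qed

section \<open>The discrete Fourier transform is unitary\<close>

text \<open>
  The inner product of columns \<open>i\<close> and \<open>j\<close> is a geometric sum over powers of a root of unity, which is 1
  only if \<open>i = j\<close>.
\<close>

lemma dft_unitary:
  assumes D: "0 < D"
  shows "is_unitary D (dft D)"
proof (rule is_unitaryI)
  define \<omega> where "\<omega> = exp (- (2 * complex_of_real pi * \<i> / of_nat D))"
  define c where "c = complex_of_real (1 / sqrt (real D))"
  have F: "dft D $$ (i, j) = c * \<omega> ^ (i * j)" if "i < D" "j < D" for i j
    using that by (simp add: dft_def \<omega>_def c_def)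
  have pw: "\<omega> ^ j = inverse (exp (2 * of_real pi * \<i> * of_nat j / of_nat D))" for j
    by (simp add: \<omega>_def exp_minus power_inverse flip: exp_of_nat_mult) (simp add: mult_ac)
  have norm: "cnj \<omega> * \<omega> = 1"
    by (simp add: \<omega>_def exp_cnj flip: exp_add)
  have inj: "i = j" if "\<omega> ^ i = \<omega> ^ j" "i < D" "j < D" for i j
    using that complex_root_unity_eq[of D i j] D by (simp add: pw)
  have one: "\<omega> ^ D = 1" using D by (simp add: pw)
  show c: "dft D \<in> carrier_mat D D" by (simp add: dft_def)
  show "mat_adjoint (dft D) * dft D = 1\<^sub>m D"
  proof (rule eq_matI)
    fix i j assume "i < dim_row (1\<^sub>m D :: complex mat)" "j < dim_col (1\<^sub>m D :: complex mat)"
    then have ij: "i < D" "j < D" by auto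
    define z where "z = cnj \<omega> ^ i * \<omega> ^ j"
    have cc: "cnj c * c = 1 / of_nat D"
      using D by (simp add: c_def flip: of_real_mult)
    have "(mat_adjoint (dft D) * dft D) $$ (i, j) = (\<Sum>k<D. cnj (c * \<omega> ^ (k * i)) * (c * \<omega> ^ (k * j)))"
      using ij c F by (subst mat_mult_index) auto
    also have "\<dots> = (\<Sum>k<D. (cnj c * c) * z ^ k)"
      by (intro sum.cong) (auto simp: z_def power_mult_distrib mult_ac simp flip: power_mult)
    also have "\<dots> = (\<Sum>k<D. z ^ k) / of_nat D"
      by (simp add: cc sum_divide_distrib)
    also have "\<dots> = (if i = j then 1 else 0)"
    proof (cases "i = j")
      case True
      then have "z = (cnj \<omega> * \<omega>) ^ i" by (simp add: z_def power_mult_distrib)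
      then show ?thesis using D True by (simp add: norm)
    next
      case False
      have "z \<noteq> 1"
      proof
        assume "z = 1"
        then have "\<omega> ^ i = (cnj \<omega> * \<omega>) ^ i * \<omega> ^ j"
          unfolding z_def power_mult_distrib by (simp add: mult_ac)
        then show False using inj[of i j] ij False by (simp add: norm)
      qed
      moreover have "z ^ D = (cnj (\<omega> ^ D)) ^ i * (\<omega> ^ D) ^ j"
        by (simp add: z_def power_mult_distrib mult_ac flip: power_mult)
      ultimately show ?thesis using False by (simp add: geometric_sum one)
    qed
    finally show "(mat_adjoint (dft D) * dft D) $$ (i, j) = 1\<^sub>m D $$ (i, j)" using ij by simp
  qed (use c in auto)
qed

lemma dft_carrier: "dft D \<in> carrier_mat D D"
  by (simp add: dft_def)

section \<open>Submatrices and zero extension\<close>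

lemma position_less_card:
  fixes S :: "nat set"
  assumes "finite S" "i \<in> S"
  shows "card {a \<in> S. a < i} < card S"
  using assms by (intro psubset_card_mono) auto

text \<open>
  \<open>pick S\<close> and the position function \<open>\<lambda>i. card {a \<in> S. a < i}\<close> are mutually inverse bijections between
  the positions \<open>{..<card S}\<close> and \<open>S\<close>. Letting \<open>g\<close> see both element and position moves sums between
  a submatrix and the full matrix.
\<close>

lemma sum_pick:
  assumes "finite S"
  shows "(\<Sum>k<card S. g (pick S k) k) = (\<Sum>i\<in>S. g i (card {a \<in> S. a < i}))"
proof (rule sum.reindex_bij_witness[where j = "pick S" and i = "\<lambda>i. card {a \<in> S. a < i}"])
  fix i assume "i \<in> S"
  then have "card {a \<in> S. a < i} < card S" by (rule position_less_card[OF assms])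
  then show "card {a \<in> S. a < i} \<in> {..<card S}" by simp
qed (auto simp: card_pick pick_in_set pick_card_in_set)

lemma submatrix_carrier:
  assumes "F \<in> carrier_mat D D" "S \<subseteq> {..<D}" "T \<subseteq> {..<D}"
  shows "submatrix F S T \<in> carrier_mat (card S) (card T)"
proof -
  have "{i. i < D \<and> i \<in> S} = S" "{i. i < D \<and> i \<in> T} = T" using assms by auto
  then show ?thesis using assms(1) by (intro carrier_matI) (simp_all add: dim_submatrix)
qed

lemma submatrix_entry:
  assumes "F \<in> carrier_mat D D" "S \<subseteq> {..<D}" "T \<subseteq> {..<D}" "k < card S" "l < card T"
  shows "submatrix F S T $$ (k, l) = F $$ (pick S k, pick T l)"
proof -
  have "{i. i < D \<and> i \<in> S} = S" "{i. i < D \<and> i \<in> T} = T" using assms by auto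
  then show ?thesis using assms by (intro submatrix_index) auto
qed

lemma submatrix_gram_complement:
  assumes F: "is_unitary D F" and S: "S \<subseteq> {..<D}" and T: "T \<subseteq> {..<D}"
  defines "A \<equiv> submatrix F S T" and "B \<equiv> submatrix F S ({..<D} - T)"
  shows "A * mat_adjoint A + B * mat_adjoint B = 1\<^sub>m (card S)"
proof (rule eq_matI)
  have Fc: "F \<in> carrier_mat D D" and FF: "F * mat_adjoint F = 1\<^sub>m D"
    using F by (auto simp: is_unitary_def)
  have Ac: "A \<in> carrier_mat (card S) (card T)" and Bc: "B \<in> carrier_mat (card S) (card ({..<D} - T))"
    using submatrix_carrier[OF Fc S] T by (auto simp: A_def B_def)
  fix k l assume "k < dim_row (1\<^sub>m (card S) :: complex mat)" "l < dim_col (1\<^sub>m (card S) :: complex mat)"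
  then have kl: "k < card S" "l < card S" by auto
  have p: "pick S k \<in> S" "pick S l \<in> S" using kl by (auto intro: pick_in_set)
  then have p': "pick S k < D" "pick S l < D" using S by auto
  have gram: "(submatrix F S R * mat_adjoint (submatrix F S R)) $$ (k, l) =
      (\<Sum>j\<in>R. F $$ (pick S k, j) * cnj (F $$ (pick S l, j)))" if R: "R \<subseteq> {..<D}" for R
  proof -
    have Rc: "submatrix F S R \<in> carrier_mat (card S) (card R)" by (rule submatrix_carrier[OF Fc S R])
    have "(submatrix F S R * mat_adjoint (submatrix F S R)) $$ (k, l) =
        (\<Sum>t<card R. F $$ (pick S k, pick R t) * cnj (F $$ (pick S l, pick R t)))"
      using Rc kl by (subst mat_mult_index) (auto simp: submatrix_entry[OF Fc S R])
    also have "\<dots> = (\<Sum>j\<in>R. F $$ (pick S k, j) * cnj (F $$ (pick S l, j)))"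
      by (rule sum_pick) (use R finite_subset in auto)
    finally show ?thesis .
  qed
  have "(A * mat_adjoint A + B * mat_adjoint B) $$ (k, l) =
      (A * mat_adjoint A) $$ (k, l) + (B * mat_adjoint B) $$ (k, l)"
    using kl Ac Bc by (intro index_add_mat(1)) auto
  also have "\<dots> = (\<Sum>j\<in>T. F $$ (pick S k, j) * cnj (F $$ (pick S l, j))) +
      (\<Sum>j\<in>{..<D} - T. F $$ (pick S k, j) * cnj (F $$ (pick S l, j)))"
    unfolding A_def B_def using T by (simp add: gram del: index_mult_mat(1))
  also have "\<dots> = (\<Sum>j<D. F $$ (pick S k, j) * cnj (F $$ (pick S l, j)))"
    by (subst sum.subset_diff[OF T]) (auto simp: add.commute)
  also have "\<dots> = (F * mat_adjoint F) $$ (pick S k, pick S l)"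
    using p' Fc by (subst mat_mult_index) auto
  also have "\<dots> = 1\<^sub>m (card S) $$ (k, l)"
    using p' kl pick_mono[of _ S] by (auto simp: FF nat_neq_iff) (metis less_irrefl)+
  finally show "(A * mat_adjoint A + B * mat_adjoint B) $$ (k, l) = 1\<^sub>m (card S) $$ (k, l)" .
next
  have "A \<in> carrier_mat (card S) (card T)" "B \<in> carrier_mat (card S) (card ({..<D} - T))"
    using submatrix_carrier[of F D S] F S T by (auto simp: A_def B_def is_unitary_def)
  then show "dim_row (A * mat_adjoint A + B * mat_adjoint B) = dim_row (1\<^sub>m (card S) :: complex mat)"
    "dim_col (A * mat_adjoint A + B * mat_adjoint B) = dim_col (1\<^sub>m (card S) :: complex mat)"
    by auto
qed

text \<open>
  The entries of \<open>X\<close> are placed at the rows in \<open>T\<close> and the columns in \<open>S\<close>: for a submatrix with rows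
  \<open>S\<close> and columns \<open>T\<close>, this is the shape of its pseudoinverse.
\<close>

definition zero_extend_mat :: "nat \<Rightarrow> nat set \<Rightarrow> nat set \<Rightarrow> complex mat \<Rightarrow> complex mat" where
  "zero_extend_mat D T S X = Matrix.mat D D (\<lambda>(i, j). if i \<in> T \<and> j \<in> S
     then X $$ (card {a \<in> T. a < i}, card {a \<in> S. a < j}) else 0)"

lemma zero_extend_mat_carrier: "zero_extend_mat D T S X \<in> carrier_mat D D"
  by (simp add: zero_extend_mat_def)

lemma frobenius2_zero_extend_mat:
  assumes S: "S \<subseteq> {..<D}" and T: "T \<subseteq> {..<D}" and X: "X \<in> carrier_mat (card T) (card S)"
  shows "frobenius2 (zero_extend_mat D T S X) = frobenius2 X"
proof -
  have fin: "finite S" "finite T" using S T finite_subset by auto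
  let ?p = "\<lambda>T i. card {a \<in> T. a < i}"
  have "frobenius2 (zero_extend_mat D T S X) =
      (\<Sum>i<D. \<Sum>j<D. if i \<in> T \<and> j \<in> S then (cmod (X $$ (?p T i, ?p S j)))\<^sup>2 else 0)"
    by (auto simp: frobenius2_def zero_extend_mat_def intro!: sum.cong)
  also have "\<dots> = (\<Sum>i\<in>T. \<Sum>j<D. if i \<in> T \<and> j \<in> S then (cmod (X $$ (?p T i, ?p S j)))\<^sup>2 else 0)"
    using T by (intro sum.mono_neutral_right) auto
  also have "\<dots> = (\<Sum>i\<in>T. \<Sum>j\<in>S. (cmod (X $$ (?p T i, ?p S j)))\<^sup>2)"
    using S by (intro sum.cong sum.mono_neutral_cong_right) auto
  also have "\<dots> = (\<Sum>k<card T. \<Sum>j\<in>S. (cmod (X $$ (k, ?p S j)))\<^sup>2)"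
    by (rule sum_pick[OF fin(2), symmetric, of "\<lambda>_ k. \<Sum>j\<in>S. (cmod (X $$ (k, ?p S j)))\<^sup>2"])
  also have "\<dots> = (\<Sum>k<card T. \<Sum>l<card S. (cmod (X $$ (k, l)))\<^sup>2)"
    by (simp add: sum_pick[OF fin(1), of "\<lambda>_ l. (cmod (X $$ (_, l)))\<^sup>2"])
  finally show ?thesis using X by (simp add: frobenius2_def)
qed

lemma mtrace_mult_zero_extend_mat:
  assumes F: "F \<in> carrier_mat D D" and S: "S \<subseteq> {..<D}" and T: "T \<subseteq> {..<D}"
    and X: "X \<in> carrier_mat (card T) (card S)"
  shows "mtrace (F * zero_extend_mat D T S X) = mtrace (submatrix F S T * X)"
proof -
  have fin: "finite S" "finite T" using S T finite_subset by auto
  let ?p = "\<lambda>T i. card {a \<in> T. a < i}"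
  have "mtrace (submatrix F S T * X) = (\<Sum>k<card S. \<Sum>l<card T. F $$ (pick S k, pick T l) * X $$ (l, k))"
    by (simp add: mtrace_mult[OF submatrix_carrier[OF F S T] X] submatrix_entry[OF F S T])
  also have "\<dots> = (\<Sum>k<card S. \<Sum>j\<in>T. F $$ (pick S k, j) * X $$ (?p T j, k))"
    by (simp add: sum_pick[OF fin(2), of "\<lambda>j l. F $$ (pick S _, j) * X $$ (l, _)"])
  also have "\<dots> = (\<Sum>i\<in>S. \<Sum>j\<in>T. F $$ (i, j) * X $$ (?p T j, ?p S i))"
    by (rule sum_pick[OF fin(1), of "\<lambda>i k. \<Sum>j\<in>T. F $$ (i, j) * X $$ (?p T j, k)"])
  also have "\<dots> = (\<Sum>i\<in>S. \<Sum>j<D. if i \<in> S \<and> j \<in> T then F $$ (i, j) * X $$ (?p T j, ?p S i) else 0)"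
    using T by (intro sum.cong sum.mono_neutral_cong_left) auto
  also have "\<dots> = (\<Sum>i<D. \<Sum>j<D. if i \<in> S \<and> j \<in> T then F $$ (i, j) * X $$ (?p T j, ?p S i) else 0)"
    using S by (intro sum.mono_neutral_left) auto
  also have "\<dots> = (\<Sum>i<D. \<Sum>j<D. F $$ (i, j) * zero_extend_mat D T S X $$ (j, i))"
    by (intro sum.cong refl) (auto simp: zero_extend_mat_def)
  also have "\<dots> = mtrace (F * zero_extend_mat D T S X)"
    by (rule mtrace_mult[OF F zero_extend_mat_carrier, symmetric])
  finally show ?thesis by simp
qed

section \<open>The estimator as a matrix and its error\<close>

definition estimator_mat :: "nat \<Rightarrow> nat set \<Rightarrow> nat set \<Rightarrow> complex mat" where
  "estimator_mat D S T = zero_extend_mat D T S (pseudoinverse (submatrix (dft D) S T))"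

lemma estimator_mat_carrier: "estimator_mat D S T \<in> carrier_mat D D"
  by (simp add: estimator_mat_def zero_extend_mat_carrier)

lemma estimator_eq_mult_mat_vec:
  assumes S: "S \<subseteq> {..<D}" and T: "T \<subseteq> {..<D}" and \<mu>: "\<mu> \<in> carrier_vec D"
  shows "estimator D S T \<mu> = estimator_mat D S T *\<^sub>v \<mu>"
proof (rule eq_vecI)
  have fin: "finite S" "finite T" using S T finite_subset by auto
  define X where "X = pseudoinverse (submatrix (dft D) S T)"
  have X: "X \<in> carrier_mat (card T) (card S)"
    unfolding X_def by (intro pseudoinverse_carrier submatrix_carrier[OF dft_carrier S T])
  have SD: "{i. i < D \<and> i \<in> S} = S" using S by auto
  fix i assume "i < dim_vec (estimator_mat D S T *\<^sub>v \<mu>)"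
  then have i: "i < D" using estimator_mat_carrier[of D S T] by auto
  let ?p = "card {a \<in> T. a < i}"
  have "(estimator_mat D S T *\<^sub>v \<mu>) $ i = (\<Sum>j<D. estimator_mat D S T $$ (i, j) * \<mu> $ j)"
    using i \<mu> estimator_mat_carrier[of D S T] by (simp add: scalar_prod_def lessThan_atLeast0)
  also have "\<dots> = (\<Sum>j<D. if j \<in> S then (if i \<in> T then X $$ (?p, card {a \<in> S. a < j}) * \<mu> $ j else 0) else 0)"
    using i by (intro sum.cong) (auto simp: estimator_mat_def zero_extend_mat_def X_def)
  also have "\<dots> = (\<Sum>j\<in>S. if i \<in> T then X $$ (?p, card {a \<in> S. a < j}) * \<mu> $ j else 0)"
    using S by (intro sum.mono_neutral_cong_right) auto
  also have "\<dots> = (\<Sum>k<card S. if i \<in> T then X $$ (?p, k) * \<mu> $ pick S k else 0)"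
    by (rule sum_pick[OF fin(1), symmetric])
  also have "\<dots> = estimator D S T \<mu> $ i"
    using i X \<mu> position_less_card[OF fin(2)]
    by (auto simp: estimator_def zero_extend_def subvec_def scalar_prod_def SD lessThan_atLeast0
        simp flip: X_def intro!: sum.cong)
  finally show "estimator D S T \<mu> $ i = (estimator_mat D S T *\<^sub>v \<mu>) $ i" by simp
qed (use estimator_mat_carrier[of D S T] in \<open>auto simp: estimator_def zero_extend_def\<close>)

lemma frobenius2_diff:
  assumes "A \<in> carrier_mat n m" "B \<in> carrier_mat n m"
  shows "frobenius2 (A - B) = frobenius2 A + frobenius2 B - 2 * Re (mtrace (mat_adjoint A * B))"
proof -
  have "mtrace (mat_adjoint A * B) = (\<Sum>j<m. \<Sum>i<n. cnj (A $$ (i, j)) * B $$ (i, j))"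
    using assms by (subst mtrace_mult[of _ m n]) auto
  also have "\<dots> = (\<Sum>i<n. \<Sum>j<m. cnj (A $$ (i, j)) * B $$ (i, j))" by (rule sum.swap)
  finally have tr: "Re (mtrace (mat_adjoint A * B)) = (\<Sum>i<n. \<Sum>j<m. Re (cnj (A $$ (i, j)) * B $$ (i, j)))"
    by (simp only: Re_sum)
  have "(cmod (a - b))\<^sup>2 = (cmod a)\<^sup>2 + (cmod b)\<^sup>2 - 2 * Re (cnj a * b)" for a b
    unfolding cmod_power2 by (simp add: power2_eq_square algebra_simps)
  then have "frobenius2 (A - B) = (\<Sum>i<n. \<Sum>j<m. (cmod (A $$ (i, j)))\<^sup>2 + (cmod (B $$ (i, j)))\<^sup>2
      - 2 * Re (cnj (A $$ (i, j)) * B $$ (i, j)))"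
    using assms unfolding frobenius2_def by (intro sum.cong) auto
  also have "\<dots> = frobenius2 A + frobenius2 B - 2 * Re (mtrace (mat_adjoint A * B))"
    unfolding tr using assms
    by (simp only: frobenius2_def sum.distrib sum_subtractf sum_distrib_left carrier_matD[OF assms(1)] carrier_matD[OF assms(2)])
  finally show ?thesis .
qed

lemma frobenius2_mult_unitary:
  assumes Y: "Y \<in> carrier_mat n D" and F: "is_unitary D F"
  shows "frobenius2 (Y * F) = frobenius2 Y"
proof -
  have Fc: "F \<in> carrier_mat D D" and FF: "F * mat_adjoint F = 1\<^sub>m D"
    using F by (auto simp: is_unitary_def)
  have "mtrace (mat_adjoint (Y * F) * (Y * F)) = mtrace (mat_adjoint F * ((mat_adjoint Y * Y) * F))"
    using Y Fc by (simp add: mat_adjoint_mult mat_mult_assoc)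
  also have "\<dots> = mtrace (((mat_adjoint Y * Y) * F) * mat_adjoint F)"
    using Y Fc by (intro mtrace_mult_comm[of _ D D]) auto
  also have "((mat_adjoint Y * Y) * F) * mat_adjoint F = (mat_adjoint Y * Y) * (F * mat_adjoint F)"
    using Y Fc by (intro mat_mult_assoc) auto
  also have "\<dots> = mat_adjoint Y * Y" using Y by (simp add: FF)
  finally show ?thesis by (simp only: frobenius2_eq_mtrace[symmetric] of_real_eq_iff)
qed

text \<open>
  Expanding the square: the cross term is the trace of \<open>A X\<close>, which is the rank, and the quadratic term
  keeps its norm because the DFT is unitary.
\<close>

theorem frobenius2_error_operator:
  assumes D: "0 < D" and S: "S \<subseteq> {..<D}" and T: "T \<subseteq> {..<D}"
  shows "frobenius2 (1\<^sub>m D - estimator_mat D S T * dft D) =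
    real D - 2 * real (vec_space.rank (card S) (submatrix (dft D) S T)) + frobenius2 (estimator_mat D S T)"
proof -
  let ?A = "submatrix (dft D) S T" and ?Y = "estimator_mat D S T"
  have Ac: "?A \<in> carrier_mat (card S) (card T)" by (rule submatrix_carrier[OF dft_carrier S T])
  note c = estimator_mat_carrier[of D S T] dft_carrier[of D]
  have one: "frobenius2 (1\<^sub>m D) = real D"
  proof -
    have "frobenius2 (1\<^sub>m D) = (\<Sum>i<D. \<Sum>j<D. if i = j then 1 else 0)"
      unfolding frobenius2_def by (intro sum.cong) auto
    then show ?thesis by simp
  qed
  have "mtrace (mat_adjoint (1\<^sub>m D) * (?Y * dft D)) = mtrace (?Y * dft D)" using c by simp
  also have "\<dots> = mtrace (dft D * ?Y)" by (rule mtrace_mult_comm[OF c])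
  also have "\<dots> = mtrace (?A * pseudoinverse ?A)"
    unfolding estimator_mat_def
    by (rule mtrace_mult_zero_extend_mat[OF dft_carrier S T pseudoinverse_carrier[OF Ac]])
  also have "\<dots> = of_nat (vec_space.rank (card S) ?A)"
    by (rule mtrace_mult_pseudoinverse_eq_rank[OF Ac])
  finally have tr: "Re (mtrace (mat_adjoint (1\<^sub>m D) * (?Y * dft D))) = real (vec_space.rank (card S) ?A)"
    by simp
  have "frobenius2 (1\<^sub>m D - ?Y * dft D) =
      frobenius2 (1\<^sub>m D) + frobenius2 (?Y * dft D) - 2 * Re (mtrace (mat_adjoint (1\<^sub>m D) * (?Y * dft D)))"
    using c by (intro frobenius2_diff[of _ D D]) auto
  then show ?thesis using one tr frobenius2_mult_unitary[OF c(1) dft_unitary[OF D]] by simp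
qed

theorem frobenius2_estimator_mat:
  assumes D: "0 < D" and S: "S \<subseteq> {..<D}" and T: "T \<subseteq> {..<D}"
  defines "B \<equiv> submatrix (dft D) S ({..<D} - T)"
  shows "frobenius2 (estimator_mat D S T) =
    (\<Sum>z\<in>#proots (char_poly (B * mat_adjoint B)). if Re z < 1 then 1 / (1 - Re z) else 0)"
proof -
  have Ac: "submatrix (dft D) S T \<in> carrier_mat (card S) (card T)"
    by (rule submatrix_carrier[OF dft_carrier S T])
  have Bc: "B \<in> carrier_mat (card S) (card ({..<D} - T))"
    unfolding B_def by (rule submatrix_carrier[OF dft_carrier S]) auto
  show ?thesis
    unfolding estimator_mat_def frobenius2_zero_extend_mat[OF S T pseudoinverse_carrier[OF Ac]]
    by (rule frobenius2_pseudoinverse_complementary[OF Ac Bc])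
      (use submatrix_gram_complement[OF dft_unitary[OF D] S T] B_def in simp)
qed

text \<open>
  The error is \<open>K b - Y e\<close>. Its entries are written with all signs in the coefficients, as linear
  combinations of the entries of \<open>b\<close> and \<open>e\<close> together.
\<close>

lemma estimation_error_eq:
  assumes S: "S \<subseteq> {..<D}" and T: "T \<subseteq> {..<D}" and b: "b \<in> carrier_vec D" and e: "e \<in> carrier_vec D"
  defines "Y \<equiv> estimator_mat D S T"
  defines "K \<equiv> 1\<^sub>m D - Y * dft D"
  shows "(vec_norm2 (b - estimator D S T (dft D *\<^sub>v b + e)))\<^sup>2 =
    (\<Sum>i<D. (cmod ((\<Sum>j<D. K $$ (i, j) * b $ j) + (\<Sum>j<D. - Y $$ (i, j) * e $ j)))\<^sup>2)"
proof -
  note c = estimator_mat_carrier[of D S T, folded Y_def] dft_carrier[of D]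
  have Kc: "K \<in> carrier_mat D D" using c by (auto simp: K_def)
  define v where "v = b - estimator D S T (dft D *\<^sub>v b + e)"
  have "v = K *\<^sub>v b - Y *\<^sub>v e"
  proof -
    have "estimator D S T (dft D *\<^sub>v b + e) = Y *\<^sub>v (dft D *\<^sub>v b + e)"
      unfolding Y_def using b e c by (intro estimator_eq_mult_mat_vec[OF S T]) auto
    also have "\<dots> = Y *\<^sub>v (dft D *\<^sub>v b) + Y *\<^sub>v e"
      using b e c by (intro mult_add_distrib_mat_vec[of _ D D]) auto
    also have "Y *\<^sub>v (dft D *\<^sub>v b) = (Y * dft D) *\<^sub>v b"
      using b c by (intro assoc_mult_mat_vec[symmetric, of _ D D _ D]) auto
    finally have "v = b - ((Y * dft D) *\<^sub>v b + Y *\<^sub>v e)" by (simp add: v_def)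
    moreover have "K *\<^sub>v b = b - (Y * dft D) *\<^sub>v b"
      unfolding K_def using b c by (subst minus_mult_distrib_mat_vec[of _ D D]) auto
    moreover have "(Y * dft D) *\<^sub>v b \<in> carrier_vec D" "Y *\<^sub>v e \<in> carrier_vec D"
      using c b e by (auto intro!: mult_mat_vec_carrier[of _ D D])
    ultimately show ?thesis using b
      by (intro eq_vecI) auto
  qed
  then have vi: "v $ i = (\<Sum>j<D. K $$ (i, j) * b $ j) + (\<Sum>j<D. - Y $$ (i, j) * e $ j)" if "i < D" for i
    using that Kc c b e by (simp add: scalar_prod_def lessThan_atLeast0 sum_negf)
  have dim: "dim_vec v = D" using \<open>v = K *\<^sub>v b - Y *\<^sub>v e\<close> c by simp
  have "(vec_norm2 v)\<^sup>2 = (\<Sum>i<D. (cmod (v $ i))\<^sup>2)"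
    by (simp add: vec_norm2_def L2_set_def dim sum_nonneg)
  then show ?thesis unfolding v_def[symmetric] using vi by simp
qed

section \<open>Second moments and independence\<close>

text \<open>
  For a family that is uncorrelated under the weight \<open>w\<close>, only the diagonal terms survive when the
  square is expanded. The weight will be the indicator of an event.
\<close>

lemma weighted_second_moment:
  fixes z :: "'i \<Rightarrow> 'a \<Rightarrow> complex" and w :: "'a \<Rightarrow> real"
  assumes fin: "finite I"
    and int: "\<And>k l. k \<in> I \<Longrightarrow> l \<in> I \<Longrightarrow> integrable M (\<lambda>x. of_real (w x) * (z k x * cnj (z l x)))"
    and mom: "\<And>k l. k \<in> I \<Longrightarrow> l \<in> I \<Longrightarrow>
      (LINT x|M. of_real (w x) * (z k x * cnj (z l x))) = (if k = l then of_real (v k) else 0)"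
  shows "integrable M (\<lambda>x. w x * (cmod (\<Sum>k\<in>I. c k * z k x))\<^sup>2)"
    and "(LINT x|M. w x * (cmod (\<Sum>k\<in>I. c k * z k x))\<^sup>2) = (\<Sum>k\<in>I. (cmod (c k))\<^sup>2 * v k)"
proof -
  define g where "g x = (\<Sum>k\<in>I. \<Sum>l\<in>I. c k * cnj (c l) * (of_real (w x) * (z k x * cnj (z l x))))" for x
  have "complex_of_real (w x * (cmod (\<Sum>k\<in>I. c k * z k x))\<^sup>2) = g x" for x
  proof -
    have "complex_of_real (w x * (cmod (\<Sum>k\<in>I. c k * z k x))\<^sup>2) =
        of_real (w x) * ((\<Sum>k\<in>I. c k * z k x) * (\<Sum>l\<in>I. cnj (c l * z l x)))"
      by (simp only: complex_norm_square cnj_sum of_real_mult)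
    also have "\<dots> = of_real (w x) * (\<Sum>k\<in>I. \<Sum>l\<in>I. (c k * z k x) * cnj (c l * z l x))"
      by (simp only: sum_product)
    also have "\<dots> = g x"
      unfolding g_def sum_distrib_left by (intro sum.cong) (simp_all add: mult_ac)
    finally show ?thesis .
  qed
  then have eq: "(\<lambda>x. complex_of_real (w x * (cmod (\<Sum>k\<in>I. c k * z k x))\<^sup>2)) = g" by (rule ext)
  have g: "integrable M g" unfolding g_def by (intro Bochner_Integration.integrable_sum integrable_mult_right int)
  have "integrable M (\<lambda>x. Re (g x))" using g by (rule integrable_Re)
  then show "integrable M (\<lambda>x. w x * (cmod (\<Sum>k\<in>I. c k * z k x))\<^sup>2)"
    unfolding eq[symmetric] by simp
  have "complex_of_real (LINT x|M. w x * (cmod (\<Sum>k\<in>I. c k * z k x))\<^sup>2) = integral\<^sup>L M g"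
    unfolding eq[symmetric] by (rule integral_complex_of_real[symmetric])
  also have "\<dots> = (\<Sum>k\<in>I. \<Sum>l\<in>I. c k * cnj (c l) * (if k = l then of_real (v k) else 0))"
    unfolding g_def by (subst Bochner_Integration.integral_sum, (intro Bochner_Integration.integrable_sum integrable_mult_right int; assumption))
      (auto intro!: sum.cong simp: int mom Bochner_Integration.integral_sum integrable_mult_right simp del: integral_mult_right_zero
        integral_mult_right)
  also have "\<dots> = (\<Sum>k\<in>I. c k * cnj (c k) * of_real (v k))"
    using fin by (simp add: if_distrib[of "\<lambda>x. _ * x"] sum.delta cong: if_cong)
  also have "\<dots> = complex_of_real (\<Sum>k\<in>I. (cmod (c k))\<^sup>2 * v k)"
    by (simp add: complex_norm_square del: of_real_power)
  finally show "(LINT x|M. w x * (cmod (\<Sum>k\<in>I. c k * z k x))\<^sup>2) = (\<Sum>k\<in>I. (cmod (c k))\<^sup>2 * v k)"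
    by (simp only: of_real_eq_iff)
qed

text \<open>
  \<open>indep_rv\<close> relates variables with values in different types; once both are mapped into the same type,
  the library notion of independence and its product rule for integrals apply.
\<close>

lemma (in prob_space) indep_rv_compose:
  fixes f :: "'b \<Rightarrow> 'd" and g :: "'c \<Rightarrow> 'd"
  assumes XY: "indep_rv N X L Y" and f: "f \<in> measurable N K" and g: "g \<in> measurable L K"
  shows "indep_var K (\<lambda>x. f (X x)) K (\<lambda>x. g (Y x))"
proof -
  have X: "X \<in> measurable M N" and Y: "Y \<in> measurable M L"
    and ind: "indep_set {X -` A \<inter> space M |A. A \<in> sets N} {Y -` B \<inter> space M |B. B \<in> sets L}"
    using XY by (auto simp: indep_rv_def)
  have sub: "{(\<lambda>x. f (X x)) -` A \<inter> space M |A. A \<in> sets K} \<subseteq> {X -` A \<inter> space M |A. A \<in> sets N}"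
  proof safe
    fix A assume "A \<in> sets K"
    then have "f -` A \<inter> space N \<in> sets N" using f by (rule measurable_sets[rotated])
    moreover have "(\<lambda>x. f (X x)) -` A \<inter> space M = X -` (f -` A \<inter> space N) \<inter> space M"
      using measurable_space[OF X] by auto
    ultimately show "\<exists>B. (\<lambda>x. f (X x)) -` A \<inter> space M = X -` B \<inter> space M \<and> B \<in> sets N" by blast
  qed
  have sub': "{(\<lambda>x. g (Y x)) -` A \<inter> space M |A. A \<in> sets K} \<subseteq> {Y -` A \<inter> space M |A. A \<in> sets L}"
  proof safe
    fix A assume "A \<in> sets K"
    then have "g -` A \<inter> space L \<in> sets L" using g by (rule measurable_sets[rotated])
    moreover have "(\<lambda>x. g (Y x)) -` A \<inter> space M = Y -` (g -` A \<inter> space L) \<inter> space M"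
      using measurable_space[OF Y] by auto
    ultimately show "\<exists>B. (\<lambda>x. g (Y x)) -` A \<inter> space M = Y -` B \<inter> space M \<and> B \<in> sets L" by blast
  qed
  have "indep_sets (\<lambda>i. {case_bool (\<lambda>x. f (X x)) (\<lambda>x. g (Y x)) i -` A \<inter> space M |A. A \<in> sets (case_bool K K i)}) UNIV"
  proof (rule indep_sets_mono_sets[OF ind[unfolded indep_set_def]])
    fix i :: bool
    show "{case_bool (\<lambda>x. f (X x)) (\<lambda>x. g (Y x)) i -` A \<inter> space M |A. A \<in> sets (case_bool K K i)}
        \<subseteq> case_bool {X -` A \<inter> space M |A. A \<in> sets N} {Y -` B \<inter> space M |B. B \<in> sets L} i"
      using sub sub' by (cases i) simp_all
  qed
  moreover have "(\<lambda>x. f (X x)) \<in> measurable M K" "(\<lambda>x. g (Y x)) \<in> measurable M K"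
    using measurable_compose[OF X f] measurable_compose[OF Y g] by auto
  ultimately show ?thesis
    unfolding indep_var_def indep_vars_def2 by (auto split: bool.split)
qed

lemma (in prob_space) indep_rv_integral_mult:
  fixes f :: "'b \<Rightarrow> complex" and g :: "'c \<Rightarrow> complex"
  assumes XY: "indep_rv N X L Y" and f: "f \<in> borel_measurable N" and g: "g \<in> borel_measurable L"
    and int: "integrable M (\<lambda>x. f (X x))" "integrable M (\<lambda>x. g (Y x))"
  shows "integrable M (\<lambda>x. f (X x) * g (Y x))"
    and "(LINT x|M. f (X x) * g (Y x)) = (LINT x|M. f (X x)) * (LINT x|M. g (Y x))"
  using indep_var_integrable[OF indep_rv_compose[OF XY f g] int]
    indep_var_lebesgue_integral[OF indep_rv_compose[OF XY f g] int] by auto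

section \<open>Moments of Gaussian vectors\<close>

lemma sets_gaussian [simp, measurable_cong]: "sets (gaussian m v) = sets borel"
  by (simp add: gaussian_def)

lemma prob_space_gaussian:
  assumes "v \<ge> 0"
  shows "prob_space (gaussian m v)"
  using assms by (auto simp: gaussian_def prob_space_return intro!: prob_space_normal_density)

lemma gaussian_centered_moments:
  assumes v: "v \<ge> 0"
  shows "integrable (gaussian 0 v) (\<lambda>x. x ^ k)"
    and "(LINT x|gaussian 0 v. x) = 0" and "(LINT x|gaussian 0 v. x\<^sup>2) = v"
proof -
  show "integrable (gaussian 0 v) (\<lambda>x. x ^ k)"
  proof (cases "v = 0")
    case True
    interpret prob_space "gaussian 0 v" by (rule prob_space_gaussian[OF v])
    have "integrable (gaussian 0 v) (\<lambda>x. (0::real) ^ k)" by simp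
    moreover have "gaussian 0 v = return borel 0" using True by (simp add: gaussian_def)
    then have "AE x in gaussian 0 v. (0::real) ^ k = x ^ k"
      by (simp only:) (subst AE_return, auto)
    ultimately show ?thesis
      by (subst integrable_cong_AE[symmetric, of "\<lambda>x. (0::real) ^ k"]) auto
  next
    case False
    then show ?thesis using v integrable_normal_moment[of "sqrt v" 0 k]
      by (simp add: gaussian_def integrable_density)
  qed
  have "(LINT x|gaussian 0 v. x) = 0 \<and> (LINT x|gaussian 0 v. x\<^sup>2) = v"
  proof (cases "v = 0")
    case True
    then show ?thesis by (simp add: gaussian_def integral_return)
  next
    case False
    then show ?thesis
      using v integral_normal_moment_nz_1[of "sqrt v" 0] integral_normal_moment_even[of "sqrt v" 0 1]
      by (simp add: gaussian_def integral_density)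
  qed
  then show "(LINT x|gaussian 0 v. x) = 0" "(LINT x|gaussian 0 v. x\<^sup>2) = v" by auto
qed

text \<open>
  All the moments are integrals of monomials \<open>\<Prod>k. (R k)^(m k)\<close>, which factor over the coordinates of
  the product measure. First and mixed second moments have a factor with \<open>m k = 1\<close>, whose
  integral is zero.
\<close>

lemma iid_gaussian_moments:
  fixes R :: "nat \<Rightarrow> 'a \<Rightarrow> real"
  assumes v: "v \<ge> 0"
    and R: "\<And>i. i < D \<Longrightarrow> R i \<in> borel_measurable M"
    and distr: "distr M (\<Pi>\<^sub>M i\<in>{..<D}. borel) (\<lambda>x. \<lambda>i\<in>{..<D}. R i x) = (\<Pi>\<^sub>M i\<in>{..<D}. gaussian 0 v)"
    and i: "i < D" and j: "j < D"
  shows "integrable M (R i)" "(LINT x|M. R i x) = 0"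
    and "integrable M (\<lambda>x. R i x * R j x)" "(LINT x|M. R i x * R j x) = (if i = j then v else 0)"
proof -
  interpret product_sigma_finite "\<lambda>i::nat. gaussian 0 v"
    by (intro product_sigma_finite.intro prob_space_imp_sigma_finite prob_space_gaussian[OF v])
  interpret G: prob_space "gaussian 0 v" by (rule prob_space_gaussian[OF v])
  define \<mu> where "\<mu> k = (LINT x|gaussian 0 v. x ^ k)" for k
  have \<mu>: "\<mu> 0 = 1" "\<mu> 1 = 0" "\<mu> 2 = v"
    using gaussian_centered_moments[OF v] G.prob_space by (simp_all add: \<mu>_def)
  have vec: "(\<lambda>x. \<lambda>i\<in>{..<D}. R i x) \<in> measurable M (\<Pi>\<^sub>M i\<in>{..<D}. borel)"
    using R by (intro measurable_restrict) auto
  have joint: "integrable M (\<lambda>x. \<Prod>k<D. R k x ^ m k) \<and> (LINT x|M. (\<Prod>k<D. R k x ^ m k)) = (\<Prod>k<D. \<mu> (m k))" for m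
  proof -
    let ?h = "\<lambda>\<omega> :: nat \<Rightarrow> real. \<Prod>k<D. \<omega> k ^ m k"
    have h: "?h \<in> borel_measurable (\<Pi>\<^sub>M i\<in>{..<D}. borel)"
      by measurable
    have eq: "(\<lambda>x. \<Prod>k<D. R k x ^ m k) = (\<lambda>x. ?h (\<lambda>i\<in>{..<D}. R i x))"
      by (auto intro!: ext prod.cong)
    have "integrable (\<Pi>\<^sub>M i\<in>{..<D}. gaussian 0 v) ?h"
      by (intro product_integrable_prod gaussian_centered_moments[OF v]) auto
    moreover have "integral\<^sup>L (\<Pi>\<^sub>M i\<in>{..<D}. gaussian 0 v) ?h = (\<Prod>k<D. \<mu> (m k))"
      unfolding \<mu>_def by (intro product_integral_prod gaussian_centered_moments[OF v]) auto
    ultimately show ?thesis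
      unfolding distr[symmetric] eq using integrable_distr_eq[OF vec h] integral_distr[OF vec h] by simp
  qed
  have pick: "(\<Prod>k<D. a k ^ of_bool (k = l)) = a l" if "l < D" for a :: "nat \<Rightarrow> real" and l
  proof -
    have "(\<Prod>k<D. a k ^ of_bool (k = l)) = (\<Prod>k<D. if k = l then a k else 1)"
      by (intro prod.cong) auto
    then show ?thesis using that by simp
  qed
  \<comment> \<open>The exponent vector of a single coordinate is the indicator of its index; a product of two adds them.\<close>
  have 1: "(\<lambda>x. \<Prod>k<D. R k x ^ of_bool (k = i)) = R i" using i by (simp add: pick)
  have "(\<Prod>k<D. \<mu> (of_bool (k = i))) = 0" using i \<mu> by (intro prod_zero) auto
  then show "integrable M (R i)" "(LINT x|M. R i x) = 0"
    using joint[of "\<lambda>k. of_bool (k = i)"] unfolding 1 by auto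
  have 2: "(\<lambda>x. \<Prod>k<D. R k x ^ (of_bool (k = i) + of_bool (k = j))) = (\<lambda>x. R i x * R j x)"
    using i j by (simp add: power_add prod.distrib pick)
  have "(\<Prod>k<D. \<mu> (of_bool (k = i) + of_bool (k = j))) = (if i = j then v else 0)"
  proof (cases "i = j")
    case True
    have "(\<Prod>k<D. \<mu> (of_bool (k = i) + of_bool (k = j))) = (\<Prod>k<D. if k = i then v else 1)"
      using True \<mu> by (intro prod.cong) (auto simp: numeral_2_eq_2)
    then show ?thesis using True i by simp
  next
    case False
    then show ?thesis using i \<mu> by (auto intro!: prod_zero bexI[of _ i])
  qed
  then show "integrable M (\<lambda>x. R i x * R j x)" "(LINT x|M. R i x * R j x) = (if i = j then v else 0)"
    using joint[of "\<lambda>k. of_bool (k = i) + of_bool (k = j)"] unfolding 2 by auto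
qed

section \<open>Conditional expectation given a finitely valued variable\<close>

text \<open>
  The quantity \<open>err (V x) x\<close> depends on \<open>V\<close> also through its first argument. Splitting over the finitely
  many values \<open>q\<close> of \<open>V\<close> freezes that argument, so the conditional expectation is \<open>r q\<close> on
  \<open>V = q\<close> as soon as each frozen \<open>err q\<close> has mean \<open>r q\<close> relative to every event \<open>V \<in> Q\<close>.
\<close>

lemma (in prob_space) real_cond_exp_finitely_valued:
  fixes err :: "'k \<Rightarrow> 'a \<Rightarrow> real" and r :: "'k \<Rightarrow> real"
  assumes K: "finite K" and V: "V \<in> measurable M (count_space K)"
    and int: "\<And>q Q. q \<in> K \<Longrightarrow> Q \<subseteq> K \<Longrightarrow> integrable M (\<lambda>x. indicator Q (V x) * err q x)"
    and avg: "\<And>q Q. q \<in> K \<Longrightarrow> Q \<subseteq> K \<Longrightarrow>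
      (LINT x|M. indicator Q (V x) * err q x) = (LINT x|M. indicator Q (V x)) * r q"
  shows "AE x in M. real_cond_exp M (vimage_algebra (space M) V (count_space K)) (\<lambda>x. err (V x) x) x = r (V x)"
proof -
  let ?G = "vimage_algebra (space M) V (count_space K)"
  have VK: "V \<in> space M \<rightarrow> space (count_space K)" using measurable_space[OF V] by auto
  have sub: "subalgebra M ?G"
    unfolding subalgebra_def using V by (auto simp: sets_vimage_algebra2[OF VK] intro: measurable_sets)
  interpret finite_measure_subalgebra M ?G by unfold_locales (rule sub)
  have indQ: "integrable M (\<lambda>x. indicator Q (V x) :: real)" if "Q \<subseteq> K" for Q
  proof -
    have "(\<lambda>x. indicator Q (V x) :: real) \<in> borel_measurable M"
      by (rule measurable_compose[OF V]) simp
    then show ?thesis by (intro integrable_const_bound[of _ 1]) auto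
  qed
  have split: "h (V x) = (\<Sum>q\<in>K. indicator {q} (V x) * h q)" if "x \<in> space M" for h :: "'k \<Rightarrow> real" and x
    using VK that K by (subst sum.remove[of _ "V x"]) (auto simp: Pi_iff indicator_def intro!: sum.neutral)
  have combine: "indicator (V -` Q \<inter> space M) x *\<^sub>R h (V x) = (\<Sum>q\<in>K. indicator (Q \<inter> {q}) (V x) * h q)"
    if "x \<in> space M" for h :: "'k \<Rightarrow> real" and x Q
    unfolding split[OF that, of h] using that by (auto simp: sum_distrib_left indicator_def intro!: sum.cong)
  have intr: "integrable M (\<lambda>x. \<Sum>q\<in>K. indicator (Q \<inter> {q}) (V x) * r q)" if "Q \<subseteq> K" for Q
    using that by (intro Bochner_Integration.integrable_sum integrable_mult_left indQ) auto
  have inte: "integrable M (\<lambda>x. \<Sum>q\<in>K. indicator (Q \<inter> {q}) (V x) * err q x)" if "Q \<subseteq> K" for Q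
    using that by (intro Bochner_Integration.integrable_sum int) auto
  show ?thesis
  proof (rule real_cond_exp_charact)
    fix A assume "A \<in> sets ?G"
    then obtain Q where A: "A = V -` Q \<inter> space M" and Q: "Q \<subseteq> K"
      by (auto simp: sets_vimage_algebra2[OF VK])
    have "(LINT x:A|M. err (V x) x) = (LINT x|M. (\<Sum>q\<in>K. indicator (Q \<inter> {q}) (V x) * err q x))"
      unfolding set_lebesgue_integral_def A using combine[of _ Q "\<lambda>q. err q _"]
      by (intro Bochner_Integration.integral_cong) auto
    also have "\<dots> = (\<Sum>q\<in>K. (LINT x|M. indicator (Q \<inter> {q}) (V x)) * r q)"
      using Q by (subst Bochner_Integration.integral_sum) (auto intro!: int avg sum.cong)
    also have "\<dots> = (LINT x|M. (\<Sum>q\<in>K. indicator (Q \<inter> {q}) (V x) * r q))"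
    proof (subst Bochner_Integration.integral_sum)
      show "integrable M (\<lambda>x. indicator (Q \<inter> {q}) (V x) * r q)" if "q \<in> K" for q
        using Q by (intro integrable_mult_left indQ) auto
    qed simp
    also have "\<dots> = (LINT x:A|M. r (V x))"
      unfolding set_lebesgue_integral_def A using combine[of _ Q r]
      by (intro Bochner_Integration.integral_cong) auto
    finally show "(LINT x:A|M. err (V x) x) = (LINT x:A|M. r (V x))" .
  next
    show "integrable M (\<lambda>x. err (V x) x)"
      using inte[of K] by (rule Bochner_Integration.integrable_cong[THEN iffD1, rotated -1])
        (use combine[of _ K "\<lambda>q. err q _"] VK in \<open>auto simp: Pi_iff\<close>)
    show "integrable M (\<lambda>x. r (V x))"
      using intr[of K] by (rule Bochner_Integration.integrable_cong[THEN iffD1, rotated -1])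
        (use combine[of _ K r] VK in \<open>auto simp: Pi_iff\<close>)
    show "(\<lambda>x. r (V x)) \<in> borel_measurable ?G"
      by (rule measurable_compose[OF measurable_vimage_algebra1[OF VK]]) simp
  qed
qed

section \<open>The mean squared error in the DFT model\<close>

lemma space_borel_vec [simp]: "space (borel_vec D) = carrier_vec D"
  by (simp add: borel_vec_def)

lemma borel_vec_coordinate_measurable [measurable (raw)]:
  assumes "i < D"
  shows "(\<lambda>v. v $ i) \<in> borel_measurable (borel_vec D)"
proof -
  have "(\<lambda>v. \<lambda>i\<in>{..<D}. v $ i) \<in> measurable (borel_vec D) (\<Pi>\<^sub>M i\<in>{..<D}. borel)"
    unfolding borel_vec_def by (intro measurable_vimage_algebra1) (auto simp: space_PiM)
  then have "(\<lambda>v. (\<lambda>i\<in>{..<D}. v $ i) i) \<in> borel_measurable (borel_vec D)"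
    by (rule measurable_compose) (use assms in \<open>auto intro!: measurable_component_singleton\<close>)
  then show ?thesis using assms by simp
qed

lemma borel_vec_cnj_coordinate_measurable:
  assumes "i < D"
  shows "(\<lambda>v. cnj (v $ i)) \<in> borel_measurable (borel_vec D)"
proof -
  have "cnj \<in> borel_measurable borel"
    by (intro borel_measurable_continuous_onI continuous_intros)
  then show ?thesis by (rule measurable_compose[OF borel_vec_coordinate_measurable[OF assms]])
qed

lemma index_sets_pair: "index_sets D \<Otimes>\<^sub>M index_sets D = count_space (Pow {..<D} \<times> Pow {..<D})"
  unfolding index_sets_def by (intro pair_measure_countable countable_finite) auto

context dft_model
begin

lemma beta_carrier: "x \<in> space M \<Longrightarrow> \<beta> x \<in> carrier_vec D"
  using measurable_space[OF beta_rv] by simp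

lemma e_carrier: "x \<in> space M \<Longrightarrow> e x \<in> carrier_vec D"
  using measurable_space[OF e_rv] by simp

lemma beta_coordinate_measurable: "i < D \<Longrightarrow> (\<lambda>x. \<beta> x $ i) \<in> borel_measurable M"
  by (rule measurable_compose[OF beta_rv borel_vec_coordinate_measurable])

lemma e_coordinate_measurable: "i < D \<Longrightarrow> (\<lambda>x. e x $ i) \<in> borel_measurable M"
  by (rule measurable_compose[OF e_rv borel_vec_coordinate_measurable])

text \<open>
  A square-integrable variable on a probability space is integrable, by \<open>a \<le> 1 + a\<^sup>2\<close>.
\<close>

lemma beta_coordinate_integrable:
  assumes i: "i < D"
  shows "integrable M (\<lambda>x. \<beta> x $ i)"
proof (rule Bochner_Integration.integrable_bound)
  show "integrable M (\<lambda>x. 1 + norm (\<beta> x $ i * cnj (\<beta> x $ i)))"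
    by (intro Bochner_Integration.integrable_add integrable_norm beta_integrable i) simp
  have "a \<le> 1 + a * a" for a :: real
    using sum_squares_ge_zero[of "a - 1" a] by (simp add: algebra_simps)
  then show "AE x in M. norm (\<beta> x $ i) \<le> norm (1 + norm (\<beta> x $ i * cnj (\<beta> x $ i)))"
    by (intro AE_I2) (simp add: norm_mult)
qed (rule beta_coordinate_measurable[OF i])

text \<open>
  Expand \<open>e\<close> into real and imaginary parts. Each part contributes half of the variance, and the mixed
  terms vanish by the independence of the two parts.
\<close>

lemma noise_moments:
  assumes i: "i < D" and j: "j < D"
  shows "integrable M (\<lambda>x. e x $ i)" "(LINT x|M. e x $ i) = 0"
    and "integrable M (\<lambda>x. e x $ i * cnj (e x $ j))"
    and "(LINT x|M. e x $ i * cnj (e x $ j)) = (if i = j then of_real (\<sigma>\<^sup>2 / real D) else 0)"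
proof -
  define v where "v = \<sigma>\<^sup>2 / (2 * real D)"
  define R where "R k x = Re (e x $ k)" for k x
  define J where "J k x = Im (e x $ k)" for k x
  have v: "v \<ge> 0" by (simp add: v_def)
  have e: "e x $ k = of_real (R k x) + \<i> * of_real (J k x)" for k x
    by (simp add: R_def J_def complex_eq_iff)
  have Rm: "R k \<in> borel_measurable M" and Jm: "J k \<in> borel_measurable M" if "k < D" for k
    unfolding R_def J_def using e_coordinate_measurable[OF that] by measurable
  have R: "integrable M (R k)" "(LINT x|M. R k x) = 0"
    "integrable M (\<lambda>x. R k x * R l x)" "(LINT x|M. R k x * R l x) = (if k = l then v else 0)"
    if "k < D" "l < D" for k l
    using iid_gaussian_moments[OF v Rm e_Re[folded R_def v_def] that] by auto
  have J: "integrable M (J k)" "(LINT x|M. J k x) = 0"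
    "integrable M (\<lambda>x. J k x * J l x)" "(LINT x|M. J k x * J l x) = (if k = l then v else 0)"
    if "k < D" "l < D" for k l
    using iid_gaussian_moments[OF v Jm e_Im[folded J_def v_def] that] by auto
  have RJ_indep: "integrable M (\<lambda>x. R k x * J l x) \<and> (LINT x|M. R k x * J l x) = 0" if "k < D" "l < D" for k l
  proof -
    have "indep_var borel ((\<lambda>\<omega>. \<omega> k) \<circ> (\<lambda>x. \<lambda>i\<in>{..<D}. R i x)) borel ((\<lambda>\<omega>. \<omega> l) \<circ> (\<lambda>x. \<lambda>i\<in>{..<D}. J i x))"
      using that unfolding R_def J_def
      by (intro indep_var_compose[OF e_Re_Im_indep] measurable_component_singleton) auto
    then have "indep_var borel (R k) borel (J l)" using that by (simp add: o_def)
    then show ?thesis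
      using indep_var_integrable[of "R k" "J l"] indep_var_lebesgue_integral[of "R k" "J l"]
        R(1,2)[OF that(1,1)] J(1)[OF that(2,2)] by simp
  qed
  have ec: "(\<lambda>x. e x $ i) = (\<lambda>x. of_real (R i x) + \<i> * of_real (J i x))"
    by (rule ext) (rule e)
  have "integrable M (\<lambda>x. complex_of_real (R i x))" "integrable M (\<lambda>x. \<i> * complex_of_real (J i x))"
    using R(1)[OF i i] J(1)[OF i i] by (auto intro!: integrable_mult_right)
  then show "integrable M (\<lambda>x. e x $ i)" "(LINT x|M. e x $ i) = 0"
    unfolding ec using R(2)[OF i i] J(2)[OF i i] by simp_all
  define a where "a x = R i x * R j x + J i x * J j x" for x
  define b where "b x = R j x * J i x - R i x * J j x" for x
  have ee: "(\<lambda>x. e x $ i * cnj (e x $ j)) = (\<lambda>x. of_real (a x) + \<i> * of_real (b x))"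
    by (rule ext) (simp add: e a_def b_def complex_eq_iff)
  have a: "integrable M a" "integral\<^sup>L M a = (if i = j then v + v else 0)"
    unfolding a_def using R(3,4)[OF i j] J(3,4)[OF i j] by simp_all
  have b: "integrable M b" "integral\<^sup>L M b = 0"
    unfolding b_def using RJ_indep[OF i j] RJ_indep[OF j i] by simp_all
  have ab: "integrable M (\<lambda>x. complex_of_real (a x))" "integrable M (\<lambda>x. \<i> * complex_of_real (b x))"
    using a b by (auto intro!: integrable_mult_right)
  show "integrable M (\<lambda>x. e x $ i * cnj (e x $ j))"
    unfolding ee using ab by simp
  have "v + v = \<sigma>\<^sup>2 / real D" using D_pos by (simp add: v_def field_simps)
  then show "(LINT x|M. e x $ i * cnj (e x $ j)) = (if i = j then of_real (\<sigma>\<^sup>2 / real D) else 0)"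
    unfolding ee using ab a b by simp
qed

abbreviation "ST_space \<equiv> index_sets D \<Otimes>\<^sub>M index_sets D"

lemma ST_measurable: "(\<lambda>x. (S x, T x)) \<in> measurable M ST_space"
  using S_rv T_rv by (intro measurable_Pair)

lemma ST_indicator_measurable:
  "(\<lambda>x. indicator Q (S x, T x) :: real) \<in> borel_measurable M"
  by (rule measurable_compose[OF ST_measurable]) (simp add: index_sets_pair)

text \<open>
  The mean squared error, in the form produced by the second moments of \<open>\<beta>\<close> and \<open>e\<close>.
\<close>

definition risk :: "nat set \<Rightarrow> nat set \<Rightarrow> real" where
  "risk S0 T0 =
     (frobenius2 (1\<^sub>m D - estimator_mat D S0 T0 * dft D) + \<sigma>\<^sup>2 * frobenius2 (estimator_mat D S0 T0)) / real D"

lemma risk_eq: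
  assumes S0: "S0 \<subseteq> {..<D}" and T0: "T0 \<subseteq> {..<D}"
  defines "A \<equiv> submatrix (dft D) S0 ({..<D} - T0)"
  shows "risk S0 T0 = 1 - 2 * real (vec_space.rank (card S0) (submatrix (dft D) S0 T0)) / real D
      + (1 + \<sigma>\<^sup>2) / real D *
        (\<Sum>z\<in>#proots (char_poly (A * mat_adjoint A)). if Re z < 1 then 1 / (1 - Re z) else 0)"
proof -
  have "(real D - 2 * r + s + \<sigma>\<^sup>2 * s) / real D = 1 - 2 * r / real D + (1 + \<sigma>\<^sup>2) / real D * s" for r s
    using D_pos by (simp add: field_simps)
  then show ?thesis
    unfolding risk_def frobenius2_error_operator[OF D_pos S0 T0]
      frobenius2_estimator_mat[OF D_pos S0 T0, folded A_def] .
qed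

text \<open>
  The combined family consists of the entries of \<open>\<beta>\<close> (\<open>Inl\<close>) and of \<open>e\<close> (\<open>Inr\<close>). As \<open>\<beta>\<close> is independent of
  \<open>(S, T, e)\<close>, its part factors out of every moment; the part of \<open>e\<close> separates from the indicator
  of \<open>(S, T) \<in> Q\<close> because \<open>e\<close> is independent of \<open>(S, T)\<close> or because the indicator is constantly 1.
\<close>

lemma restricted_second_moments:
  fixes Q
  defines "w \<equiv> (\<lambda>x. indicator Q (S x, T x) :: real)"
    and "z \<equiv> case_sum (\<lambda>j x. \<beta> x $ j) (\<lambda>j x. e x $ j)"
    and "var \<equiv> case_sum (\<lambda>j :: nat. 1 / real D) (\<lambda>j :: nat. \<sigma>\<^sup>2 / real D)"
  assumes noise: "indep_rv (borel_vec D) e ST_space (\<lambda>x. (S x, T x)) \<or> (\<forall>x\<in>space M. (S x, T x) \<in> Q)"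
    and k: "k \<in> {..<D} <+> {..<D}" and l: "l \<in> {..<D} <+> {..<D}"
  shows "integrable M (\<lambda>x. of_real (w x) * (z k x * cnj (z l x)))"
    and "(LINT x|M. of_real (w x) * (z k x * cnj (z l x))) =
      (if k = l then of_real ((LINT x|M. w x) * var k) else 0)"
proof -
  let ?w = "\<lambda>x. complex_of_real (w x)"
  define c where "c = (LINT x|M. w x)"
  have w_meas: "?w \<in> borel_measurable M"
    unfolding w_def using ST_indicator_measurable[of Q] by measurable
  have w_int: "integrable M ?w"
    by (rule integrable_const_bound[of _ 1]) (auto simp: w_def w_meas[unfolded w_def])
  have w_E: "(LINT x|M. ?w x) = of_real c" by (simp add: c_def)
  have w_mult: "integrable M (\<lambda>x. ?w x * h x)" if "integrable M h" for h :: "'w \<Rightarrow> complex"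
    using that by (rule Bochner_Integration.integrable_bound)
      (use that w_meas in \<open>auto simp: w_def norm_mult indicator_def intro!: AE_I2\<close>)
  have e_part: "(LINT x|M. ?w x * h (e x)) = of_real c * (LINT x|M. h (e x))"
    if h: "h \<in> borel_measurable (borel_vec D)" and int: "integrable M (\<lambda>x. h (e x))" for h
    using noise
  proof
    assume ind: "indep_rv (borel_vec D) e ST_space (\<lambda>x. (S x, T x))"
    have "(\<lambda>q. complex_of_real (indicator Q q)) \<in> borel_measurable ST_space"
      by (simp add: index_sets_pair)
    then show ?thesis
      using indep_rv_integral_mult(2)[OF ind h, of "\<lambda>q. complex_of_real (indicator Q q)"] int w_int w_E
      by (simp add: w_def mult.commute)
  next
    assume "\<forall>x\<in>space M. (S x, T x) \<in> Q"
    then have w1: "w x = 1" if "x \<in> space M" for x using that by (simp add: w_def)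
    have "c = 1" unfolding c_def
      by (subst Bochner_Integration.integral_cong[OF refl w1]) (simp_all add: prob_space)
    moreover have "(LINT x|M. ?w x * h (e x)) = (LINT x|M. h (e x))"
      using w1 by (intro Bochner_Integration.integral_cong) auto
    ultimately show ?thesis by simp
  qed
  have beta_part:
    "integrable M (\<lambda>x. ?w x * (f (\<beta> x) * g (e x)))"
    "(LINT x|M. ?w x * (f (\<beta> x) * g (e x))) = (LINT x|M. f (\<beta> x)) * (LINT x|M. ?w x * g (e x))"
    if f: "f \<in> borel_measurable (borel_vec D)" and g: "g \<in> borel_measurable (borel_vec D)"
      and int: "integrable M (\<lambda>x. f (\<beta> x))" "integrable M (\<lambda>x. g (e x))" for f g
  proof -
    let ?h = "\<lambda>(s, t, y). complex_of_real (indicator Q (s, t)) * g y"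
    have "(\<lambda>y. complex_of_real (indicator Q (fst y, fst (snd y))))
        \<in> borel_measurable (index_sets D \<Otimes>\<^sub>M index_sets D \<Otimes>\<^sub>M borel_vec D)"
    proof (rule measurable_compose[of _ _ ST_space])
      show "(\<lambda>y. (fst y, fst (snd y))) \<in> (index_sets D \<Otimes>\<^sub>M index_sets D \<Otimes>\<^sub>M borel_vec D) \<rightarrow>\<^sub>M ST_space"
        by measurable
    qed (simp add: index_sets_pair)
    moreover have "(\<lambda>y. g (snd (snd y))) \<in> borel_measurable (index_sets D \<Otimes>\<^sub>M index_sets D \<Otimes>\<^sub>M borel_vec D)"
      by (rule measurable_compose[OF _ g]) measurable
    ultimately have h: "?h \<in> borel_measurable (index_sets D \<Otimes>\<^sub>M index_sets D \<Otimes>\<^sub>M borel_vec D)"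
      unfolding case_prod_beta by (rule borel_measurable_times)
    have hi: "integrable M (\<lambda>x. ?h (S x, T x, e x))" using w_mult[OF int(2)] by (simp add: w_def)
    show "integrable M (\<lambda>x. ?w x * (f (\<beta> x) * g (e x)))"
      using indep_rv_integral_mult(1)[OF beta_indep f h int(1) hi] by (simp add: w_def mult_ac)
    show "(LINT x|M. ?w x * (f (\<beta> x) * g (e x))) = (LINT x|M. f (\<beta> x)) * (LINT x|M. ?w x * g (e x))"
      using indep_rv_integral_mult(2)[OF beta_indep f h int(1) hi] by (simp add: w_def mult_ac)
  qed
  have cross: "integrable M (\<lambda>x. ?w x * (\<beta> x $ i * cnj (e x $ j)))"
      "(LINT x|M. ?w x * (\<beta> x $ i * cnj (e x $ j))) = 0" if ij: "i < D" "j < D" for i j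
  proof -
    have m: "(\<lambda>v. v $ i) \<in> borel_measurable (borel_vec D)" "(\<lambda>v. cnj (v $ j)) \<in> borel_measurable (borel_vec D)"
      using ij by (auto intro!: borel_vec_coordinate_measurable borel_vec_cnj_coordinate_measurable)
    have int: "integrable M (\<lambda>x. \<beta> x $ i)" "integrable M (\<lambda>x. cnj (e x $ j))"
      using beta_coordinate_integrable noise_moments ij by auto
    show "integrable M (\<lambda>x. ?w x * (\<beta> x $ i * cnj (e x $ j)))" by (rule beta_part(1)[OF m int])
    show "(LINT x|M. ?w x * (\<beta> x $ i * cnj (e x $ j))) = 0"
      unfolding beta_part(2)[OF m int] e_part[OF m(2) int(2)] using noise_moments(2)[OF ij(2,2)] by simp
  qed
  have "integrable M (\<lambda>x. ?w x * (z k x * cnj (z l x))) \<and>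
    (LINT x|M. ?w x * (z k x * cnj (z l x))) = (if k = l then of_real (c * var k) else 0)"
  proof (cases k; cases l)
    fix i j assume kl: "k = Inl i" "l = Inl j"
    then have ij: "i < D" "j < D" using k l by auto
    have m: "(\<lambda>v. v $ i * cnj (v $ j)) \<in> borel_measurable (borel_vec D)"
      using ij by (auto intro!: borel_measurable_times borel_vec_coordinate_measurable
          borel_vec_cnj_coordinate_measurable)
    show ?thesis
      using beta_part[OF m borel_measurable_const[of 1] beta_integrable[OF ij]] w_int w_E beta_second_moment[OF ij]
      by (simp add: kl z_def var_def)
  next
    fix i j assume kl: "k = Inl i" "l = Inr j"
    then have ij: "i < D" "j < D" using k l by auto
    show ?thesis using cross[OF ij] by (simp add: kl z_def)
  next
    fix i j assume kl: "k = Inr i" "l = Inl j"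
    then have ij: "j < D" "i < D" using k l by auto
    have eq: "(\<lambda>x. ?w x * (z k x * cnj (z l x))) = (\<lambda>x. cnj (?w x * (\<beta> x $ j * cnj (e x $ i))))"
      by (simp add: kl z_def mult_ac)
    show ?thesis unfolding eq using cross[OF ij] by (simp add: kl del: complex_cnj_mult)
  next
    fix i j assume kl: "k = Inr i" "l = Inr j"
    then have ij: "i < D" "j < D" using k l by auto
    have m: "(\<lambda>v. v $ i * cnj (v $ j)) \<in> borel_measurable (borel_vec D)"
      using ij by (auto intro!: borel_measurable_times borel_vec_coordinate_measurable
          borel_vec_cnj_coordinate_measurable)
    show ?thesis
      using w_mult[OF noise_moments(3)[OF ij]] e_part[OF m noise_moments(3)[OF ij]] noise_moments(4)[OF ij]
      by (simp add: kl z_def var_def)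
  qed
  then show "integrable M (\<lambda>x. ?w x * (z k x * cnj (z l x)))"
    "(LINT x|M. ?w x * (z k x * cnj (z l x))) = (if k = l then of_real ((LINT x|M. w x) * var k) else 0)"
    by (auto simp: c_def)
qed

definition sq_error :: "nat set \<Rightarrow> nat set \<Rightarrow> 'w \<Rightarrow> real" where
  "sq_error S0 T0 x = (vec_norm2 (\<beta> x - estimator D S0 T0 (dft D *\<^sub>v \<beta> x + e x)))\<^sup>2"

text \<open>
  The squared error is a sum over \<open>i\<close> of squared linear combinations of the combined family. Their
  coefficients are row \<open>i\<close> of \<open>I - Y F\<close> and of \<open>- Y\<close>, whose squares add up to Frobenius norms.
\<close>

lemma restricted_mean_sq_error:
  assumes S0: "S0 \<subseteq> {..<D}" and T0: "T0 \<subseteq> {..<D}"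
    and noise: "indep_rv (borel_vec D) e ST_space (\<lambda>x. (S x, T x)) \<or> (\<forall>x\<in>space M. (S x, T x) \<in> Q)"
  shows "integrable M (\<lambda>x. indicator Q (S x, T x) * sq_error S0 T0 x)"
    and "(LINT x|M. indicator Q (S x, T x) * sq_error S0 T0 x) =
      (LINT x|M. indicator Q (S x, T x)) * risk S0 T0"
proof -
  let ?I = "{..<D} <+> {..<D}"
  let ?w = "\<lambda>x. indicator Q (S x, T x) :: real"
  define Y where "Y = estimator_mat D S0 T0"
  define K where "K = 1\<^sub>m D - Y * dft D"
  define z where "z = case_sum (\<lambda>j x. \<beta> x $ j) (\<lambda>j x. e x $ j)"
  define var where "var = case_sum (\<lambda>j :: nat. 1 / real D) (\<lambda>j :: nat. \<sigma>\<^sup>2 / real D)"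
  define a where "a i = case_sum (\<lambda>j. K $$ (i, j)) (\<lambda>j. - Y $$ (i, j))" for i
  define c where "c = (LINT x|M. ?w x)"
  have dims: "Y \<in> carrier_mat D D" "K \<in> carrier_mat D D"
    using estimator_mat_carrier[of D S0 T0] dft_carrier[of D] by (auto simp: Y_def K_def)
  have err: "?w x * sq_error S0 T0 x = (\<Sum>i<D. ?w x * (cmod (\<Sum>k\<in>?I. a i k * z k x))\<^sup>2)"
    if x: "x \<in> space M" for x
    unfolding sq_error_def estimation_error_eq[OF S0 T0 beta_carrier[OF x] e_carrier[OF x]]
    by (simp add: sum.Plus a_def z_def K_def Y_def sum_distrib_left)
  note mom = restricted_second_moments[OF noise, folded z_def var_def c_def]
  have row: "integrable M (\<lambda>x. ?w x * (cmod (\<Sum>k\<in>?I. a i k * z k x))\<^sup>2)"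
    "(LINT x|M. ?w x * (cmod (\<Sum>k\<in>?I. a i k * z k x))\<^sup>2) = (\<Sum>k\<in>?I. (cmod (a i k))\<^sup>2 * (c * var k))" for i
    using weighted_second_moment[of ?I M ?w z "\<lambda>k. c * var k" "a i", OF _ mom] by auto
  show "integrable M (\<lambda>x. ?w x * sq_error S0 T0 x)"
    using Bochner_Integration.integrable_sum[of "{..<D}" M, OF row(1)]
    by (subst Bochner_Integration.integrable_cong[OF refl err]) auto
  have "(LINT x|M. ?w x * sq_error S0 T0 x) = (LINT x|M. (\<Sum>i<D. ?w x * (cmod (\<Sum>k\<in>?I. a i k * z k x))\<^sup>2))"
    by (rule Bochner_Integration.integral_cong[OF refl err])
  also have "\<dots> = (\<Sum>i<D. \<Sum>k\<in>?I. (cmod (a i k))\<^sup>2 * (c * var k))"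
    by (simp only: Bochner_Integration.integral_sum row)
  also have "\<dots> = (\<Sum>i<D. \<Sum>j<D. (cmod (K $$ (i, j)))\<^sup>2 * (c / real D))
      + (\<Sum>i<D. \<Sum>j<D. (cmod (Y $$ (i, j)))\<^sup>2 * (c * \<sigma>\<^sup>2 / real D))"
    by (simp add: sum.Plus a_def var_def sum.distrib)
  also have "\<dots> = frobenius2 K * (c / real D) + frobenius2 Y * (c * \<sigma>\<^sup>2 / real D)"
    by (simp only: frobenius2_def sum_distrib_right carrier_matD[OF dims(1)] carrier_matD[OF dims(2)])
  also have "\<dots> = c * risk S0 T0"
    by (simp add: risk_def flip: K_def Y_def) (simp add: K_def Y_def add_divide_distrib algebra_simps)
  finally show "(LINT x|M. ?w x * sq_error S0 T0 x) = (LINT x|M. ?w x) * risk S0 T0"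
    by (simp add: c_def)
qed

theorem mean_sq_error:
  assumes "S0 \<subseteq> {..<D}" "T0 \<subseteq> {..<D}"
  shows "expectation (sq_error S0 T0) = risk S0 T0"
  using restricted_mean_sq_error(2)[OF assms, of UNIV] by (simp add: prob_space)

theorem conditional_mean_sq_error:
  assumes "indep_rv (borel_vec D) e ST_space (\<lambda>x. (S x, T x))"
  shows "AE x in M. real_cond_exp M (vimage_algebra (space M) (\<lambda>x. (S x, T x)) ST_space)
    (\<lambda>x. sq_error (S x) (T x) x) x = risk (S x) (T x)"
  using real_cond_exp_finitely_valued[of "Pow {..<D} \<times> Pow {..<D}" "\<lambda>x. (S x, T x)"
      "\<lambda>q. sq_error (fst q) (snd q)" "\<lambda>q. risk (fst q) (snd q)"]
    ST_measurable restricted_mean_sq_error assms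
  by (auto simp: index_sets_pair)

end

theorem theorem1:
  fixes M :: "'w measure" and D :: nat and n p \<sigma> :: real
    and \<beta> e :: "'w \<Rightarrow> complex Matrix.vec" and S T :: "'w \<Rightarrow> nat set"
  assumes model: "dft_model M D n p \<sigma> \<beta> e S T"
  shows
    "let F = dft D;
         err = (\<lambda>S0 T0 x. (vec_norm2 (\<beta> x - estimator D S0 T0 (F *\<^sub>v \<beta> x + e x)))\<^sup>2);
         rhs = (\<lambda>S0 T0.
           let A = submatrix F S0 ({..<D} - T0);
               \<Lambda> = proots (char_poly (A * mat_adjoint A))
           in 1 - 2 * real (vec_space.rank (card S0) (submatrix F S0 T0)) / real D
              + (1 + \<sigma>\<^sup>2) / real D *
                (\<Sum>z\<in>#\<Lambda>. if Re z < 1 then 1 / (1 - Re z) else 0))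
     in (\<forall>S0 T0. S0 \<subseteq> {..<D} \<longrightarrow> T0 \<subseteq> {..<D} \<longrightarrow>
           prob_space.expectation M (err S0 T0) = rhs S0 T0)
      \<and> (prob_space.indep_rv M (borel_vec D) e
            (index_sets D \<Otimes>\<^sub>M index_sets D) (\<lambda>x. (S x, T x)) \<longrightarrow>
         (AE x in M.
            real_cond_exp M
              (vimage_algebra (space M) (\<lambda>x. (S x, T x)) (index_sets D \<Otimes>\<^sub>M index_sets D))
              (\<lambda>x. err (S x) (T x) x) x
            = rhs (S x) (T x)))"
proof -
  interpret dft_model M D n p \<sigma> \<beta> e S T by (rule model)
  show ?thesis
    unfolding Let_def
  proof (intro conjI allI impI)
    fix S0 T0 assume "S0 \<subseteq> {..<D}" "T0 \<subseteq> {..<D}"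
    then show "expectation (\<lambda>x. (vec_norm2 (\<beta> x - estimator D S0 T0 (dft D *\<^sub>v \<beta> x + e x)))\<^sup>2) =
        1 - 2 * real (vec_space.rank (card S0) (submatrix (dft D) S0 T0)) / real D + (1 + \<sigma>\<^sup>2) / real D *
        (\<Sum>z\<in>#proots (char_poly (submatrix (dft D) S0 ({..<D} - T0) * mat_adjoint (submatrix (dft D) S0 ({..<D} - T0)))).
          if Re z < 1 then 1 / (1 - Re z) else 0)"
      using mean_sq_error[of S0 T0] risk_eq[of S0 T0] by (simp add: sq_error_def[abs_def])
  next
    assume ind: "indep_rv (borel_vec D) e (index_sets D \<Otimes>\<^sub>M index_sets D) (\<lambda>x. (S x, T x))"
    have ran: "S x \<subseteq> {..<D}" "T x \<subseteq> {..<D}" if "x \<in> space M" for x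
      using measurable_space[OF S_rv that] measurable_space[OF T_rv that] by (auto simp: index_sets_def)
    show "AE x in M. real_cond_exp M
        (vimage_algebra (space M) (\<lambda>x. (S x, T x)) (index_sets D \<Otimes>\<^sub>M index_sets D))
        (\<lambda>x. (vec_norm2 (\<beta> x - estimator D (S x) (T x) (dft D *\<^sub>v \<beta> x + e x)))\<^sup>2) x =
        1 - 2 * real (vec_space.rank (card (S x)) (submatrix (dft D) (S x) (T x))) / real D + (1 + \<sigma>\<^sup>2) / real D *
        (\<Sum>z\<in>#proots (char_poly (submatrix (dft D) (S x) ({..<D} - T x) * mat_adjoint (submatrix (dft D) (S x) ({..<D} - T x)))).
          if Re z < 1 then 1 / (1 - Re z) else 0)"
      using conditional_mean_sq_error[OF ind] AE_space
      by eventually_elim (simp add: sq_error_def risk_eq ran)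
  qed
qed

end
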